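(* Let $G$ be a compact Lie group with Lie algebra $\mathfrak g$ acting by quaternionic isometries on a quaternion-Kähler manifold $M$ with moment map $\mu=\sum_{i=1}^3 I_i\otimes B_i$, where $B_i=\lambda v_i$ with $(v_1,v_2,v_3)$ an orthonormal basis of $V=\Psi(x)$ and $\lambda>0$ a differentiable $G$-invariant function, and let $\Psi:M_0\to\mathbb{G}_3(\mathfrak g)$ be the induced map. Let $x\in M_0$ and $Y\in T_xM$, and write $$\Psi_*Y=v_1\otimes p_1+v_2\otimes p_2+v_3\otimes p_3,\qquad p_i\in V^\perp.$$ Then $$\Psi_*(I_1Y)=\frac1\lambda\,v_1\otimes\rho(Y^\flat)-v_2\otimes p_3+v_3\otimes p_2 .$$
   Context: $M$ is a connected quaternion-Kähler (QK) manifold with nonzero scalar curvature. $S^2H$ denotes the real rank 3 bundle of endomorphisms of $TM$ locally spanned by almost complex structures $I_1,I_2,I_3$, compatible with the metric, with $I_i^2=-\mathrm{Id}$, $I_iI_j=I_k$ for $(i,j,k)$ cyclic; it is preserved by the Levi-Civita connection $\nabla$. $G$ acts by isometries preserving the QK structure; $\tilde A$ is the Killing field on $M$ generated by $A\in\mathfrak g$. $\mathfrak g$ has the inner product given by minus the Killing form (assumed positive definite). The moment map is the section $\mu$ of $S^2H\otimes\mathfrak g$ whose contractions $\mu_A=\langle\mu,A\rangle$ satisfy $\nabla\mu_A=\sum_{i=1}^3 (I_i\tilde A)^\flat\otimes I_i$ (the constant factor, the scalar curvature, is normalized to $1$). Locally $\mu=\sum_i I_i\otimes B_i$ with $B_i$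 $\mathfrak g$-valued; $M_0\subset M$ is the set of points where $B_1,B_2,B_3$ are linearly independent, and $\Psi(x)$ is the oriented 3-plane $\mathrm{span}\{B_1(x),B_2(x),B_3(x)\}$. $\mathbb{G}_3(\mathfrak g)$ is the Grassmannian of oriented 3-planes in $\mathfrak g$, with $T_V\mathbb{G}_3(\mathfrak g)=\mathrm{Hom}(V,V^\perp)\cong V\otimes V^\perp$ and the tensor product metric. $Y^\flat\in T^*_xM$ is the dual of $Y$ under the metric of $M$. The map $\rho:T_x^*M\to V^\perp$ is $\rho(\zeta)=\sum_r\langle\zeta,\tilde A_r\rangle A_r$, where $(A_r)$ is an orthonormal basis of $V^\perp\subset\mathfrak g$ and $\langle\zeta,\tilde A_r\rangle$ is the pairing of the covector $\zeta$ with the vector $\tilde A_r(x)$. *)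

theory Defs
  imports
    "HOL-Analysis.Analysis"
    "HOL-Algebra.Group_Action"
    "HOL-Library.Function_Algebras"
begin

section \<open>Pointwise real vector space structure on functions\<close>

instantiation "fun" :: (type, real_vector) real_vector
begin

definition scaleR_fun :: "real \<Rightarrow> ('a \<Rightarrow> 'b) \<Rightarrow> 'a \<Rightarrow> 'b"
  where "scaleR_fun c f = (\<lambda>x. c *\<^sub>R f x)"

instance
  by standard (simp_all add: scaleR_fun_def fun_eq_iff scaleR_add_right scaleR_add_left)

end

lemma scaleR_fun_apply [simp]: "(c *\<^sub>R f) x = c *\<^sub>R f x"
  by (simp add: scaleR_fun_def)

definition lin_on :: "'a::real_vector set \<Rightarrow> ('a \<Rightarrow> 'b::real_vector) \<Rightarrow> bool"
  where "lin_on S L \<longleftrightarrow>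
    (\<forall>v\<in>S. \<forall>w\<in>S. L (v + w) = L v + L w) \<and> (\<forall>c. \<forall>v\<in>S. L (c *\<^sub>R v) = c *\<^sub>R L v)"

section \<open>Smooth manifolds\<close>

text \<open>\<open>Ck_on\<close> and \<open>smooth_on\<close> are used only for open \<open>S\<close>: they express that
  all iterated directional derivatives exist as Frechet derivatives and are continuous.\<close>

primrec Ck_on :: "nat \<Rightarrow> 'a::euclidean_space set \<Rightarrow> ('a \<Rightarrow> 'b::real_normed_vector) \<Rightarrow> bool"
  where
    "Ck_on 0 S f \<longleftrightarrow> continuous_on S f"
  | "Ck_on (Suc k) S f \<longleftrightarrow> (\<forall>x\<in>S. f differentiable (at x)) \<and>
        (\<forall>v. Ck_on k S (\<lambda>x. frechet_derivative f (at x) v))"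

definition smooth_on :: "'a::euclidean_space set \<Rightarrow> ('a \<Rightarrow> 'b::real_normed_vector) \<Rightarrow> bool"
  where "smooth_on S f \<longleftrightarrow> (\<forall>k. Ck_on k S f)"

text \<open>A chart is a pair of its domain and its coordinate map.  The manifold is the whole
  type \<open>'m\<close>, modelled on the Euclidean space \<open>'e\<close>.\<close>

type_synonym ('m, 'e) chart = "'m set \<times> ('m \<Rightarrow> 'e)"

definition smooth_atlas ::
  "('m::{t2_space, second_countable_topology}, 'e::euclidean_space) chart set \<Rightarrow> bool"
  where "smooth_atlas A \<longleftrightarrow>
    (\<Union>(U, \<phi>)\<in>A. U) = UNIV \<and>
    (\<forall>(U, \<phi>)\<in>A. open U \<and> open (\<phi> ` U) \<and> homeomorphism U (\<phi> ` U) \<phi> (inv_into U \<phi>)) \<and>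
    (\<forall>(U, \<phi>)\<in>A. \<forall>(V, \<psi>)\<in>A. smooth_on (\<phi> ` (U \<inter> V)) (\<psi> \<circ> inv_into U \<phi>))"

definition prod_atlas ::
  "('m, 'e) chart set \<Rightarrow> ('n, 'f) chart set \<Rightarrow> ('m \<times> 'n, 'e \<times> 'f) chart set"
  where "prod_atlas A A' = {(U \<times> V, map_prod \<phi> \<psi>) | U \<phi> V \<psi>. (U, \<phi>) \<in> A \<and> (V, \<psi>) \<in> A'}"

definition smooth_map ::
  "('m::topological_space, 'e::euclidean_space) chart set \<Rightarrow>
   ('n::topological_space, 'f::euclidean_space) chart set \<Rightarrow> ('m \<Rightarrow> 'n) \<Rightarrow> bool"
  where "smooth_map A A' F \<longleftrightarrow> continuous_on UNIV F \<and>
    (\<forall>(U, \<phi>)\<in>A. \<forall>(V, \<psi>)\<in>A'. smooth_on (\<phi> ` (U \<inter> F -` V)) (\<psi> \<circ> F \<circ> inv_into U \<phi>))"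

definition smooth_fun ::
  "('m, 'e::euclidean_space) chart set \<Rightarrow> 'm set \<Rightarrow> ('m \<Rightarrow> 'b::real_normed_vector) \<Rightarrow> bool"
  where "smooth_fun A W f \<longleftrightarrow> (\<forall>(U, \<phi>)\<in>A. smooth_on (\<phi> ` (U \<inter> W)) (f \<circ> inv_into U \<phi>))"

definition smooth_near ::
  "('m::topological_space, 'e::euclidean_space) chart set \<Rightarrow> 'm \<Rightarrow> ('m \<Rightarrow> real) \<Rightarrow> bool"
  where "smooth_near A p f \<longleftrightarrow> (\<exists>W. open W \<and> p \<in> W \<and> smooth_fun A W f)"

text \<open>Tangent vectors at \<open>p\<close> are derivations of germs at \<open>p\<close> of smooth functions.  They are
  represented as functionals on all functions, with value \<open>0\<close> on those not smooth near \<open>p\<close>.\<close>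

type_synonym 'm tvec = "('m \<Rightarrow> real) \<Rightarrow> real"
type_synonym 'm vfield = "'m \<Rightarrow> 'm tvec"
type_synonym 'm endo = "'m tvec \<Rightarrow> 'm tvec"

definition tangent_space ::
  "('m::topological_space, 'e::euclidean_space) chart set \<Rightarrow> 'm \<Rightarrow> 'm tvec set"
  where "tangent_space A p = {v.
    (\<forall>f. \<not> smooth_near A p f \<longrightarrow> v f = 0) \<and>
    (\<forall>f h. smooth_near A p f \<and> eventually (\<lambda>y. f y = h y) (nhds p) \<longrightarrow> v f = v h) \<and>
    (\<forall>f h. smooth_near A p f \<and> smooth_near A p h \<longrightarrow>
        v (\<lambda>y. f y + h y) = v f + v h \<and>
        v (\<lambda>y. f y * h y) = f p * v h + h p * v f) \<and>
    (\<forall>c f. smooth_near A p f \<longrightarrow> v (\<lambda>y. c * f y) = c * v f)}"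

definition smooth_vfield ::
  "('m::topological_space, 'e::euclidean_space) chart set \<Rightarrow> 'm set \<Rightarrow> 'm vfield \<Rightarrow> bool"
  where "smooth_vfield A U Z \<longleftrightarrow> (\<forall>y\<in>U. Z y \<in> tangent_space A y) \<and>
    (\<forall>W f. open W \<and> W \<subseteq> U \<and> smooth_fun A W f \<longrightarrow> smooth_fun A W (\<lambda>y. Z y f))"

definition pushforward ::
  "('n::topological_space, 'f::euclidean_space) chart set \<Rightarrow> ('m \<Rightarrow> 'n) \<Rightarrow> 'm \<Rightarrow> 'm tvec \<Rightarrow> 'n tvec"
  where "pushforward A' F p v = (\<lambda>f. if smooth_near A' (F p) f then v (f \<circ> F) else 0)"

definition lie_bracket ::
  "('m::topological_space, 'e::euclidean_space) chart set \<Rightarrow> 'm vfield \<Rightarrow> 'm vfield \<Rightarrow> 'm vfield"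
  where "lie_bracket A X Y p =
    (\<lambda>f. if smooth_near A p f then X p (\<lambda>y. Y y f) - Y p (\<lambda>y. X y f) else 0)"

text \<open>Endomorphisms of the tangent space at \<open>p\<close>, extended by \<open>0\<close> to all functionals.\<close>

definition endos ::
  "('m::topological_space, 'e::euclidean_space) chart set \<Rightarrow> 'm \<Rightarrow> 'm endo set"
  where "endos A p = {L. lin_on (tangent_space A p) L \<and>
    L ` tangent_space A p \<subseteq> tangent_space A p \<and> (\<forall>v. v \<notin> tangent_space A p \<longrightarrow> L v = 0)}"

definition smooth_endo ::
  "('m::topological_space, 'e::euclidean_space) chart set \<Rightarrow> 'm set \<Rightarrow> ('m \<Rightarrow> 'm endo) \<Rightarrow> bool"
  where "smooth_endo A U J \<longleftrightarrow> (\<forall>y\<in>U. J y \<in> endos A y) \<and>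
    (\<forall>W Z. open W \<and> W \<subseteq> U \<and> smooth_vfield A W Z \<longrightarrow> smooth_vfield A W (\<lambda>y. J y (Z y)))"

section \<open>Riemannian metrics, Levi-Civita connection, scalar curvature\<close>

type_synonym 'm metric = "'m \<Rightarrow> 'm tvec \<Rightarrow> 'm tvec \<Rightarrow> real"

definition riemannian_metric ::
  "('m::topological_space, 'e::euclidean_space) chart set \<Rightarrow> 'm metric \<Rightarrow> bool"
  where "riemannian_metric A g \<longleftrightarrow>
    (\<forall>p. \<forall>v\<in>tangent_space A p.
        lin_on (tangent_space A p) (g p v) \<and>
        (\<forall>w\<in>tangent_space A p. g p v w = g p w v) \<and>
        (v \<noteq> 0 \<longrightarrow> g p v v > 0)) \<and>
    (\<forall>U X Y. open U \<and> smooth_vfield A U X \<and> smooth_vfield A U Y \<longrightarrow>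
        smooth_fun A U (\<lambda>y. g y (X y) (Y y)))"

text \<open>\<open>D p v Z\<close> is the covariant derivative at \<open>p\<close>, in direction \<open>v\<close>, of a vector field \<open>Z\<close>
  that is smooth on some neighbourhood of \<open>p\<close>; nothing is required of other arguments.\<close>

type_synonym 'm conn = "'m \<Rightarrow> 'm tvec \<Rightarrow> 'm vfield \<Rightarrow> 'm tvec"

definition affine_connection ::
  "('m::topological_space, 'e::euclidean_space) chart set \<Rightarrow> 'm conn \<Rightarrow> bool"
  where "affine_connection A D \<longleftrightarrow>
    (\<forall>U p Z. open U \<and> p \<in> U \<and> smooth_vfield A U Z \<longrightarrow>
        (\<forall>v\<in>tangent_space A p. D p v Z \<in> tangent_space A p) \<and>
        lin_on (tangent_space A p) (\<lambda>v. D p v Z) \<and>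
        (\<forall>v\<in>tangent_space A p. \<forall>Z'. (\<forall>y\<in>U. Z' y = Z y) \<longrightarrow> D p v Z' = D p v Z) \<and>
        (\<forall>v\<in>tangent_space A p. \<forall>Z'. smooth_vfield A U Z' \<longrightarrow>
            D p v (\<lambda>y. Z y + Z' y) = D p v Z + D p v Z') \<and>
        (\<forall>v\<in>tangent_space A p. \<forall>f. smooth_fun A U f \<longrightarrow>
            D p v (\<lambda>y. f y *\<^sub>R Z y) = v f *\<^sub>R Z p + f p *\<^sub>R D p v Z)) \<and>
    (\<forall>U X Z. open U \<and> smooth_vfield A U X \<and> smooth_vfield A U Z \<longrightarrow>
        smooth_vfield A U (\<lambda>y. D y (X y) Z))"

definition levi_civita ::
  "('m::topological_space, 'e::euclidean_space) chart set \<Rightarrow> 'm metric \<Rightarrow> 'm conn \<Rightarrow> bool"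
  where "levi_civita A g D \<longleftrightarrow> affine_connection A D \<and>
    (\<forall>U X Y p. open U \<and> p \<in> U \<and> smooth_vfield A U X \<and> smooth_vfield A U Y \<longrightarrow>
        D p (X p) Y - D p (Y p) X = lie_bracket A X Y p \<and>
        (\<forall>v\<in>tangent_space A p.
            v (\<lambda>y. g y (X y) (Y y)) = g p (D p v X) (Y p) + g p (X p) (D p v Y)))"

text \<open>\<open>L\<close> is the covariant derivative at \<open>p\<close>, in direction \<open>v\<close>, of the endomorphism field \<open>J\<close>
  for the connection induced on endomorphisms of the tangent bundle.\<close>

definition has_cov_deriv ::
  "('m::topological_space, 'e::euclidean_space) chart set \<Rightarrow> 'm conn \<Rightarrow> 'm \<Rightarrow> 'm tvec \<Rightarrow>
   ('m \<Rightarrow> 'm endo) \<Rightarrow> 'm endo \<Rightarrow> bool"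
  where "has_cov_deriv A D p v J L \<longleftrightarrow> L \<in> endos A p \<and>
    (\<forall>U Z. open U \<and> p \<in> U \<and> smooth_vfield A U Z \<longrightarrow>
        D p v (\<lambda>y. J y (Z y)) = L (Z p) + J p (D p v Z))"

definition curvature ::
  "('m::topological_space, 'e::euclidean_space) chart set \<Rightarrow> 'm conn \<Rightarrow>
   'm vfield \<Rightarrow> 'm vfield \<Rightarrow> 'm vfield \<Rightarrow> 'm vfield"
  where "curvature A D X Y Z p =
    D p (X p) (\<lambda>y. D y (Y y) Z) - D p (Y p) (\<lambda>y. D y (X y) Z) - D p (lie_bracket A X Y p) Z"

definition orthonormal_frame ::
  "('m::topological_space, 'e::euclidean_space) chart set \<Rightarrow> 'm metric \<Rightarrow> 'm set \<Rightarrow>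
   ('e \<Rightarrow> 'm vfield) \<Rightarrow> bool"
  where "orthonormal_frame A g U X \<longleftrightarrow> open U \<and>
    (\<forall>a\<in>Basis. smooth_vfield A U (X a)) \<and>
    (\<forall>y\<in>U. \<forall>a\<in>Basis. \<forall>b\<in>Basis. g y (X a y) (X b y) = (if a = b then 1 else 0))"

definition scalar_curvature ::
  "('m::topological_space, 'e::euclidean_space) chart set \<Rightarrow> 'm metric \<Rightarrow> 'm conn \<Rightarrow> 'm \<Rightarrow> real"
  where "scalar_curvature A g D p = (THE s. \<forall>U X. p \<in> U \<and> orthonormal_frame A g U X \<longrightarrow>
    s = (\<Sum>a\<in>Basis. \<Sum>b\<in>Basis. g p (curvature A D (X a) (X b) (X b) p) (X a p)))"

section \<open>Quaternion-Kaehler manifolds\<close>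

text \<open>\<open>Q x\<close> is the fibre of \<open>S\<^sup>2H\<close> at \<open>x\<close>.  Frames are indexed by the three-element type \<open>3\<close>,
  whose arithmetic is modulo 3, so \<open>(i, i + 1, i + 2)\<close> runs through the cyclic triples.\<close>

definition quaternionic_frame ::
  "('m::topological_space, 'e::euclidean_space) chart set \<Rightarrow> 'm metric \<Rightarrow> ('m \<Rightarrow> 'm endo set) \<Rightarrow>
   'm set \<Rightarrow> (3 \<Rightarrow> 'm \<Rightarrow> 'm endo) \<Rightarrow> bool"
  where "quaternionic_frame A g Q U I \<longleftrightarrow> open U \<and> (\<forall>i. smooth_endo A U (I i)) \<and>
    (\<forall>y\<in>U.
        (\<forall>i. \<forall>v\<in>tangent_space A y. I i y (I i y v) = - v) \<and>
        (\<forall>i. \<forall>v\<in>tangent_space A y. I i y (I (i + 1) y v) = I (i + 2) y v) \<and>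
        (\<forall>i. \<forall>v\<in>tangent_space A y. \<forall>w\<in>tangent_space A y.
            g y (I i y v) (I i y w) = g y v w) \<and>
        Q y = span (range (\<lambda>i. I i y)))"

definition qk_manifold ::
  "('m::{t2_space, second_countable_topology}, 'e::euclidean_space) chart set \<Rightarrow> 'm metric \<Rightarrow>
   'm conn \<Rightarrow> ('m \<Rightarrow> 'm endo set) \<Rightarrow> bool"
  where "qk_manifold A g D Q \<longleftrightarrow>
    smooth_atlas A \<and> connected (UNIV :: 'm set) \<and>
    riemannian_metric A g \<and> levi_civita A g D \<and>
    (\<forall>x. \<exists>U I. x \<in> U \<and> quaternionic_frame A g Q U I) \<and>
    (\<forall>U J p. open U \<and> p \<in> U \<and> smooth_endo A U J \<and> (\<forall>y\<in>U. J y \<in> Q y) \<longrightarrow>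
        (\<forall>v\<in>tangent_space A p. \<exists>L\<in>Q p. has_cov_deriv A D p v J L))"

section \<open>Lie groups and quaternionic isometric actions\<close>

definition lie_group ::
  "('g::{t2_space, second_countable_topology}, 'f::euclidean_space) chart set \<Rightarrow> 'g monoid \<Rightarrow> bool"
  where "lie_group AG G \<longleftrightarrow> group G \<and> carrier G = UNIV \<and> smooth_atlas AG \<and>
    smooth_map (prod_atlas AG AG) AG (\<lambda>(h, k). h \<otimes>\<^bsub>G\<^esub> k) \<and>
    smooth_map AG AG (\<lambda>h. inv\<^bsub>G\<^esub> h)"

definition left_invariant ::
  "('g::topological_space, 'f::euclidean_space) chart set \<Rightarrow> 'g monoid \<Rightarrow> 'g tvec \<Rightarrow> 'g vfield"
  where "left_invariant AG G v = (\<lambda>h. pushforward AG (\<lambda>k. h \<otimes>\<^bsub>G\<^esub> k) \<one>\<^bsub>G\<^esub> v)"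

text \<open>The Lie algebra is the type \<open>'l\<close> with bracket \<open>br\<close>, identified by \<open>\<iota>\<close> with the tangent
  space at the identity, equipped with the bracket of left-invariant vector fields.\<close>

definition lie_algebra_of ::
  "('g::topological_space, 'f::euclidean_space) chart set \<Rightarrow> 'g monoid \<Rightarrow>
   ('l::real_vector \<Rightarrow> 'l \<Rightarrow> 'l) \<Rightarrow> ('l \<Rightarrow> 'g tvec) \<Rightarrow> bool"
  where "lie_algebra_of AG G br \<iota> \<longleftrightarrow> linear \<iota> \<and>
    bij_betw \<iota> UNIV (tangent_space AG \<one>\<^bsub>G\<^esub>) \<and>
    (\<forall>a b. \<iota> (br a b) =
       lie_bracket AG (left_invariant AG G (\<iota> a)) (left_invariant AG G (\<iota> b)) \<one>\<^bsub>G\<^esub>)"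

text \<open>\<open>tr (ad a \<circ> ad b)\<close>; the trace is computed in the standard basis of \<open>'l\<close>.\<close>

definition killing_form :: "('l::euclidean_space \<Rightarrow> 'l \<Rightarrow> 'l) \<Rightarrow> 'l \<Rightarrow> 'l \<Rightarrow> real"
  where "killing_form br a b = (\<Sum>e\<in>Basis. br a (br b e) \<bullet> e)"

definition smooth_action ::
  "('g::topological_space, 'f::euclidean_space) chart set \<Rightarrow>
   ('m::topological_space, 'e::euclidean_space) chart set \<Rightarrow> 'g monoid \<Rightarrow>
   ('g \<Rightarrow> 'm \<Rightarrow> 'm) \<Rightarrow> bool"
  where "smooth_action AG A G act \<longleftrightarrow>
    group_action G UNIV act \<and> smooth_map (prod_atlas AG A) A (\<lambda>(h, x). act h x)"

definition quaternionic_isometry ::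
  "('m::topological_space, 'e::euclidean_space) chart set \<Rightarrow> 'm metric \<Rightarrow> ('m \<Rightarrow> 'm endo set) \<Rightarrow>
   ('m \<Rightarrow> 'm) \<Rightarrow> bool"
  where "quaternionic_isometry A g Q F \<longleftrightarrow> bij F \<and> smooth_map A A F \<and> smooth_map A A (inv_into UNIV F) \<and>
    (\<forall>x. \<forall>v\<in>tangent_space A x. \<forall>w\<in>tangent_space A x.
        g (F x) (pushforward A F x v) (pushforward A F x w) = g x v w) \<and>
    (\<forall>x. \<forall>J\<in>Q x. \<exists>J'\<in>Q (F x). \<forall>v\<in>tangent_space A x.
        J' (pushforward A F x v) = pushforward A F x (J v))"

text \<open>The value at \<open>x\<close> of the vector field generated by \<open>a\<close>, i.e. the velocity at \<open>t = 0\<close> of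
  \<open>exp (t a) \<cdot> x\<close>, is the image of \<open>a\<close> under the differential of the orbit map of \<open>x\<close>.\<close>

definition generated_field ::
  "('m::topological_space, 'e::euclidean_space) chart set \<Rightarrow> 'g monoid \<Rightarrow> ('g \<Rightarrow> 'm \<Rightarrow> 'm) \<Rightarrow>
   ('l \<Rightarrow> 'g tvec) \<Rightarrow> 'l \<Rightarrow> 'm vfield"
  where "generated_field A G act \<iota> a x = pushforward A (\<lambda>h. act h x) \<one>\<^bsub>G\<^esub> (\<iota> a)"

section \<open>Moment maps\<close>

text \<open>A section \<open>\<mu>\<close> of \<open>S\<^sup>2H \<otimes> \<gg>\<close> is given by its contractions \<open>\<mu> x a = \<langle>\<mu>, a\<rangle>(x)\<close>, using
  the inner product to identify \<open>Q x \<otimes> \<gg>\<close> with the linear maps from \<open>\<gg>\<close> to \<open>Q x\<close>.\<close>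

definition moment_map ::
  "('m::topological_space, 'e::euclidean_space) chart set \<Rightarrow> 'm metric \<Rightarrow> 'm conn \<Rightarrow>
   ('m \<Rightarrow> 'm endo set) \<Rightarrow> ('l::euclidean_space \<Rightarrow> 'm vfield) \<Rightarrow> ('m \<Rightarrow> 'l \<Rightarrow> 'm endo) \<Rightarrow> bool"
  where "moment_map A g D Q K \<mu> \<longleftrightarrow>
    (\<forall>x. linear (\<mu> x)) \<and> (\<forall>x a. \<mu> x a \<in> Q x) \<and> (\<forall>a. smooth_endo A UNIV (\<lambda>x. \<mu> x a)) \<and>
    (\<forall>U I x a. quaternionic_frame A g Q U I \<and> x \<in> U \<longrightarrow>
        (\<forall>v\<in>tangent_space A x. has_cov_deriv A D x v (\<lambda>y. \<mu> y a)
            (\<Sum>i\<in>UNIV. g x (I i x (K a x)) v *\<^sub>R I i x)))"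

text \<open>\<open>\<mu> = \<Sum>\<^sub>i I\<^sub>i \<otimes> B\<^sub>i\<close> on \<open>U\<close>.\<close>

definition moment_expression ::
  "('m::topological_space, 'e::euclidean_space) chart set \<Rightarrow> 'm metric \<Rightarrow> ('m \<Rightarrow> 'm endo set) \<Rightarrow>
   ('m \<Rightarrow> 'l::euclidean_space \<Rightarrow> 'm endo) \<Rightarrow> 'm set \<Rightarrow> (3 \<Rightarrow> 'm \<Rightarrow> 'm endo) \<Rightarrow> (3 \<Rightarrow> 'm \<Rightarrow> 'l) \<Rightarrow> bool"
  where "moment_expression A g Q \<mu> U I B \<longleftrightarrow> quaternionic_frame A g Q U I \<and>
    (\<forall>i. smooth_fun A U (B i)) \<and>
    (\<forall>y\<in>U. \<forall>a. \<mu> y a = (\<Sum>i\<in>UNIV. (B i y \<bullet> a) *\<^sub>R I i y))"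

definition regular_set ::
  "('m::topological_space, 'e::euclidean_space) chart set \<Rightarrow> 'm metric \<Rightarrow> ('m \<Rightarrow> 'm endo set) \<Rightarrow>
   ('m \<Rightarrow> 'l::euclidean_space \<Rightarrow> 'm endo) \<Rightarrow> 'm set"
  where "regular_set A g Q \<mu> = {x. \<exists>U I B. moment_expression A g Q \<mu> U I B \<and> x \<in> U \<and>
    inj (\<lambda>i. B i x) \<and> independent (range (\<lambda>i. B i x))}"

section \<open>Oriented 3-planes and the induced map to the Grassmannian\<close>

text \<open>An oriented 3-plane is represented by the set of its positively oriented bases.\<close>

definition oriented_span :: "(3 \<Rightarrow> 'l::real_vector) \<Rightarrow> (3 \<Rightarrow> 'l) set"
  where "oriented_span b = {c. \<exists>M :: real^3^3. det M > 0 \<and>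
    (\<forall>i. c i = (\<Sum>j\<in>UNIV. M $ i $ j *\<^sub>R b j))}"

definition underlying_plane :: "(3 \<Rightarrow> 'l::real_vector) set \<Rightarrow> 'l set"
  where "underlying_plane P = (\<Union>c\<in>P. span (range c))"

text \<open>The map \<open>\<Psi>\<close>.  The description does not depend on the local frame, since quaternionic
  frames differ by functions with values in \<open>SO(3)\<close>; it is meaningful on \<open>regular_set\<close>.\<close>

definition induced_map ::
  "('m::topological_space, 'e::euclidean_space) chart set \<Rightarrow> 'm metric \<Rightarrow> ('m \<Rightarrow> 'm endo set) \<Rightarrow>
   ('m \<Rightarrow> 'l::euclidean_space \<Rightarrow> 'm endo) \<Rightarrow> 'm \<Rightarrow> (3 \<Rightarrow> 'l) set"
  where "induced_map A g Q \<mu> x = (THE P. \<exists>U I B. moment_expression A g Q \<mu> U I B \<and> x \<in> U \<and>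
    P = oriented_span (\<lambda>i. B i x))"

text \<open>\<open>Hom(V, V\<^sup>\<bottom>)\<close>, each map being extended by \<open>0\<close> on \<open>V\<^sup>\<bottom>\<close>; accordingly the elementary
  tensor \<open>v \<otimes> p\<close> with \<open>v \<in> V\<close> and \<open>p \<in> V\<^sup>\<bottom>\<close> is the map \<open>w \<mapsto> \<langle>v, w\<rangle> p\<close>.\<close>

definition hom_perp :: "'l::euclidean_space set \<Rightarrow> ('l \<Rightarrow> 'l) set"
  where "hom_perp V = {L. linear L \<and> L ` V \<subseteq> V\<^sup>\<bottom> \<and> (\<forall>w\<in>V\<^sup>\<bottom>. L w = 0)}"

definition tensor :: "'l::real_inner \<Rightarrow> 'l \<Rightarrow> 'l \<Rightarrow> 'l"
  where "tensor v p = (\<lambda>w. (v \<bullet> w) *\<^sub>R p)"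

text \<open>The standard chart of the oriented Grassmannian centred at the oriented plane \<open>P\<close> with
  underlying plane \<open>V\<close>: it takes values in \<open>Hom(V, V\<^sup>\<bottom>)\<close> and sends an oriented plane near \<open>P\<close> to
  the map \<open>L\<close> whose graph it is, oriented such that \<open>v \<mapsto> v + L v\<close> preserves orientation.
  The derivative of this chart at \<open>P\<close> is the identification of the tangent space of the
  Grassmannian at \<open>P\<close> with \<open>Hom(V, V\<^sup>\<bottom>)\<close>.\<close>

definition grassmann_chart :: "(3 \<Rightarrow> 'l::euclidean_space) set \<Rightarrow> (3 \<Rightarrow> 'l) set \<Rightarrow> 'l \<Rightarrow> 'l"
  where "grassmann_chart P P' = (THE L. L \<in> hom_perp (underlying_plane P) \<and>
    (\<forall>c\<in>P. (\<lambda>i. c i + L (c i)) \<in> P'))"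

text \<open>The differential at \<open>x\<close> of a map \<open>\<Phi>\<close> into the Grassmannian, applied to the tangent
  vector \<open>Y\<close>: the derivative along \<open>Y\<close> of \<open>\<Phi>\<close> read in the chart centred at \<open>\<Phi> x\<close>.\<close>

definition grassmann_differential ::
  "('m \<Rightarrow> (3 \<Rightarrow> 'l::euclidean_space) set) \<Rightarrow> 'm \<Rightarrow> 'm tvec \<Rightarrow> 'l \<Rightarrow> 'l"
  where "grassmann_differential \<Phi> x Y =
    (\<lambda>w. \<Sum>e\<in>Basis. Y (\<lambda>y. grassmann_chart (\<Phi> x) (\<Phi> y) w \<bullet> e) *\<^sub>R e)"

definition flat :: "'m metric \<Rightarrow> 'm \<Rightarrow> 'm tvec \<Rightarrow> 'm tvec \<Rightarrow> real"
  where "flat g x Y = (\<lambda>Z. g x Y Z)"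

definition orthonormal_basis_of :: "'l::euclidean_space set \<Rightarrow> 'l set \<Rightarrow> bool"
  where "orthonormal_basis_of S R \<longleftrightarrow>
    finite R \<and> pairwise orthogonal R \<and> (\<forall>a\<in>R. norm a = 1) \<and> span R = S"

definition orthonormal_triple_of :: "'l::euclidean_space set \<Rightarrow> (3 \<Rightarrow> 'l) \<Rightarrow> bool"
  where "orthonormal_triple_of S v \<longleftrightarrow>
    (\<forall>i j. v i \<bullet> v j = (if i = j then 1 else 0)) \<and> span (range v) = S"

definition rho :: "('l::euclidean_space \<Rightarrow> 'm vfield) \<Rightarrow> 'm \<Rightarrow> 'l set \<Rightarrow> ('m tvec \<Rightarrow> real) \<Rightarrow> 'l"
  where "rho K x R \<zeta> = (\<Sum>a\<in>R. \<zeta> (K a x) *\<^sub>R a)"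

end

theory Submission
  imports Defs
begin

text \<open>
Write \<open>K\<^sub>a\<close> for the vector field generated by \<open>a\<close>.  The proof computes \<open>\<Psi>\<^sub>* X\<close> for every tangent
vector \<open>X\<close> at \<open>x\<close>:
  \<open>\<Psi>\<^sub>* X = \<Sum>\<^sub>j v\<^sub>j \<otimes> q\<^sub>j X\<close> with \<open>q\<^sub>j X = (1/\<lambda>) \<Sum>\<^sub>a \<langle>I\<^sub>j K\<^sub>a, X\<rangle> a\<close>, summed over the vectors \<open>a\<close> of an
orthonormal basis of \<open>V\<^sup>\<bottom>\<close> (\<open>grassmann_differential_induced_map\<close>).  The theorem follows by setting
\<open>X = Y\<close> and \<open>X = I\<^sub>1 Y\<close>: the \<open>I\<^sub>i\<close> are skew and isometric, so \<open>\<langle>I\<^sub>1 K\<^sub>a, I\<^sub>1 Y\<rangle> = \<langle>K\<^sub>a, Y\<rangle>\<close>,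
\<open>\<langle>I\<^sub>2 K\<^sub>a, I\<^sub>1 Y\<rangle> = - \<langle>I\<^sub>3 K\<^sub>a, Y\<rangle>\<close> and \<open>\<langle>I\<^sub>3 K\<^sub>a, I\<^sub>1 Y\<rangle> = \<langle>I\<^sub>2 K\<^sub>a, Y\<rangle>\<close>.

The formula for \<open>q\<^sub>j\<close> has two ingredients.  The moment map equation, contracted with \<open>a \<in> V\<^sup>\<bottom>\<close>, gives
\<open>X \<langle>B\<^sub>j, a\<rangle> = \<langle>I\<^sub>j K\<^sub>a, X\<rangle>\<close> at \<open>x\<close>; the derivatives of the frame do not enter since \<open>\<langle>B\<^sub>j, a\<rangle> = 0\<close> there
(\<open>moment_derivative\<close>).  And in the chart of the Grassmannian centred at \<open>\<Psi> x\<close>, the plane spanned by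
the \<open>B\<^sub>i(y)\<close> is the graph of an explicit map built from the inverse of the matrix
\<open>\<langle>B\<^sub>i(y), v\<^sub>j\<rangle>\<close> (\<open>grassmann_chart_eq\<close>), whose derivative at \<open>x\<close> is the normal part of \<open>(1/\<lambda>) X B\<^sub>i\<close>.

Two points need care because of the abstract definitions.  That \<open>\<Psi> y\<close> is the span of the \<open>B\<^sub>i(y)\<close> for
any local frame rests on the fact that quaternionic frames at a point differ by a matrix of positive
determinant (\<open>frame_transition\<close>).  And tangent vectors are derivations of germs, so one needs the
algebra of smooth functions, coordinate vector fields to obtain nonzero tangent vectors, and the
smoothness of orbit maps to know that \<open>K\<^sub>a\<close> is tangent.
\<close>

section \<open>Calculus of iterated directional derivatives\<close>

lemma Ck_on_subset: "Ck_on k T f \<Longrightarrow> S \<subseteq> T \<Longrightarrow> Ck_on k S f"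
  by (induction k arbitrary: f) (auto intro: continuous_on_subset)

text \<open>The recursion in \<open>Ck_on\<close> passes through \<open>frechet_derivative\<close>, which only sees germs; on an open
  set, functions that agree therefore have the same derivatives and the recursion goes through.\<close>

lemma Ck_on_cong:
  assumes "open S" "\<And>x. x \<in> S \<Longrightarrow> f x = h x" "Ck_on k S f"
  shows "Ck_on k S h"
  using assms(2,3)
proof (induction k arbitrary: f h)
  case 0
  then show ?case by (metis Ck_on.simps(1) continuous_on_cong)
next
  case (Suc k)
  have d: "(h has_derivative frechet_derivative f (at x)) (at x)" if "x \<in> S" for x
    using Suc.prems that assms(1)
    by (metis Ck_on.simps(2) frechet_derivative_works has_derivative_transform_within_open)
  then have "frechet_derivative f (at x) = frechet_derivative h (at x)" if "x \<in> S" for x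
    using that frechet_derivative_at by blast
  then have "Ck_on k S (\<lambda>x. frechet_derivative h (at x) v)" for v
    using Suc.IH[of "\<lambda>x. frechet_derivative f (at x) v"] Suc.prems(2) by simp
  with d show ?case
    by (auto simp: differentiable_def)
qed

lemma Ck_on_SucD: "Ck_on (Suc k) S f \<Longrightarrow> Ck_on k S f"
proof (induction k arbitrary: f)
  case 0
  then show ?case
    by (auto intro!: continuous_at_imp_continuous_on differentiable_imp_continuous_within)
next
  case (Suc k)
  then show ?case by auto
qed

text \<open>Any family of derivatives found by the differentiation rules may stand in for
  \<open>frechet_derivative\<close>, so that the closure properties below reduce to the usual derivative formulas.\<close>

lemma Ck_on_SucI:
  assumes "open S" "\<And>x. x \<in> S \<Longrightarrow> (f has_derivative F x) (at x)" "\<And>v. Ck_on k S (\<lambda>x. F x v)"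
  shows "Ck_on (Suc k) S f"
proof -
  have "F x = frechet_derivative f (at x)" if "x \<in> S" for x
    using assms(2) that frechet_derivative_at by blast
  then have "Ck_on k S (\<lambda>x. frechet_derivative f (at x) v)" for v
    using Ck_on_cong[OF assms(1) _ assms(3)[of v]] by simp
  with assms(2) show ?thesis
    by (auto simp: differentiable_def)
qed

lemma Ck_on_has_derivative:
  "Ck_on (Suc k) S f \<Longrightarrow> x \<in> S \<Longrightarrow> (f has_derivative frechet_derivative f (at x)) (at x)"
  by (simp add: frechet_derivative_works)

lemma Ck_on_const: "open S \<Longrightarrow> Ck_on k S (\<lambda>x. c)"
proof (induction k arbitrary: c)
  case (Suc k)
  show ?case by (rule Ck_on_SucI[where F = "\<lambda>_ _. 0"]) (use Suc in auto)
qed auto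

lemma Ck_on_bounded_linear:
  assumes "bounded_linear L" "open S" "Ck_on k S f"
  shows "Ck_on k S (\<lambda>x. L (f x))"
  using assms(3)
proof (induction k arbitrary: f)
  case 0
  then show ?case using assms(1) by (simp add: bounded_linear.continuous_on)
next
  case (Suc k)
  show ?case
  proof (rule Ck_on_SucI[where F = "\<lambda>x v. L (frechet_derivative f (at x) v)", OF assms(2)])
    show "((\<lambda>x. L (f x)) has_derivative (\<lambda>v. L (frechet_derivative f (at x) v))) (at x)"
      if "x \<in> S" for x
      using bounded_linear.has_derivative[OF assms(1)] Ck_on_has_derivative[OF Suc.prems that]
      by blast
  qed (use Suc in auto)
qed

lemma Ck_on_add:
  assumes "open S" "Ck_on k S f" "Ck_on k S h"
  shows "Ck_on k S (\<lambda>x. f x + h x)"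
  using assms(2,3)
proof (induction k arbitrary: f h)
  case 0
  then show ?case by (simp add: continuous_on_add)
next
  case (Suc k)
  show ?case
    by (rule Ck_on_SucI[where F = "\<lambda>x v. frechet_derivative f (at x) v + frechet_derivative h (at x) v"])
       (use Suc assms(1) in \<open>auto intro!: has_derivative_add simp: frechet_derivative_works[symmetric]\<close>)
qed

lemma Ck_on_scaleR:
  assumes "open S" "Ck_on k S f" "Ck_on k S h"
  shows "Ck_on k S (\<lambda>x. f x *\<^sub>R h x)"
  using assms(2,3)
proof (induction k arbitrary: f h)
  case 0
  then show ?case by (simp add: continuous_on_scaleR)
next
  case (Suc k)
  show ?case
  proof (rule Ck_on_SucI[OF assms(1)])
    show "((\<lambda>x. f x *\<^sub>R h x) has_derivative
        (\<lambda>v. f x *\<^sub>R frechet_derivative h (at x) v + frechet_derivative f (at x) v *\<^sub>R h x)) (at x)"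
      if "x \<in> S" for x
      using has_derivative_scaleR[OF Ck_on_has_derivative[OF Suc.prems(1) that]
          Ck_on_has_derivative[OF Suc.prems(2) that]] .
    show "Ck_on k S (\<lambda>x. f x *\<^sub>R frechet_derivative h (at x) v + frechet_derivative f (at x) v *\<^sub>R h x)" for v
      using Suc.prems by (intro Ck_on_add Suc.IH assms(1) Ck_on_SucD[OF Suc.prems(1)]
          Ck_on_SucD[OF Suc.prems(2)]) auto
  qed
qed

lemma Ck_on_inverse:
  fixes f :: "'a::euclidean_space \<Rightarrow> real"
  assumes "open S" "\<And>x. x \<in> S \<Longrightarrow> f x \<noteq> 0" "Ck_on k S f"
  shows "Ck_on k S (\<lambda>x. inverse (f x))"
  using assms(3)
proof (induction k)
  case 0
  then show ?case using assms(2) by (auto intro: continuous_on_inverse)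
next
  case (Suc k)
  have inv: "Ck_on k S (\<lambda>x. inverse (f x))" using Suc Ck_on_SucD by blast
  show ?case
  proof (rule Ck_on_SucI[OF assms(1)])
    show "((\<lambda>x. inverse (f x)) has_derivative
        (\<lambda>v. - (inverse (f x) *\<^sub>R (frechet_derivative f (at x) v *\<^sub>R inverse (f x))))) (at x)"
      if "x \<in> S" for x
      using Deriv.has_derivative_inverse[OF assms(2)[OF that] Ck_on_has_derivative[OF Suc.prems that]]
      by (simp add: mult.assoc)
    show "Ck_on k S (\<lambda>x. - (inverse (f x) *\<^sub>R (frechet_derivative f (at x) v *\<^sub>R inverse (f x))))" for v
      using Suc.prems
      by (intro Ck_on_bounded_linear[OF bounded_linear_minus[OF bounded_linear_ident]]
          Ck_on_scaleR assms(1) inv) auto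
  qed
qed

lemma Ck_on_sum:
  assumes "open S" "\<And>i. i \<in> J \<Longrightarrow> Ck_on k S (f i)"
  shows "Ck_on k S (\<lambda>x. \<Sum>i\<in>J. f i x)"
  using assms(2)
  by (induction J rule: infinite_finite_induct) (auto intro!: Ck_on_const Ck_on_add assms(1))

text \<open>The chain rule is expanded in the standard basis, \<open>D(h \<circ> F) v = \<Sum>\<^sub>b \<langle>DF v, b\<rangle> (D\<^sub>b h \<circ> F)\<close>: each
  \<open>D\<^sub>b h \<circ> F\<close> is again a composition with the same inner map \<open>F\<close>, with one derivative less.\<close>

lemma Ck_on_compose:
  fixes F :: "'a::euclidean_space \<Rightarrow> 'b::euclidean_space"
  assumes "open S" "open T" "F ` S \<subseteq> T" "Ck_on k S F" "Ck_on k T h"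
  shows "Ck_on k S (\<lambda>x. h (F x))"
  using assms(4,5)
proof (induction k arbitrary: h)
  case 0
  then show ?case using assms(3) by (auto intro: continuous_on_compose2)
next
  case (Suc k)
  show ?case
  proof (rule Ck_on_SucI[OF assms(1)])
    let ?d = "\<lambda>x v. \<Sum>b\<in>Basis. (frechet_derivative F (at x) v \<bullet> b) *\<^sub>R frechet_derivative h (at (F x)) b"
    show "((\<lambda>x. h (F x)) has_derivative ?d x) (at x)" if "x \<in> S" for x
    proof -
      have h: "(h has_derivative frechet_derivative h (at (F x))) (at (F x))"
        using Suc.prems(2) assms(3) that by (intro Ck_on_has_derivative) auto
      have "frechet_derivative h (at (F x)) (frechet_derivative F (at x) v) = ?d x v" for v
        by (subst (1) euclidean_representation[symmetric, of "frechet_derivative F (at x) v"])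
          (simp only: linear_sum[OF has_derivative_linear[OF h]]
            linear_scale[OF has_derivative_linear[OF h]])
      then show ?thesis
        using has_derivative_compose[OF Ck_on_has_derivative[OF Suc.prems(1) that] h]
        by simp
    qed
    show "Ck_on k S (\<lambda>x. ?d x v)" for v
      using Suc.prems Ck_on_SucD[OF Suc.prems(1)]
      by (intro Ck_on_sum Ck_on_scaleR Suc.IH assms(1) Ck_on_bounded_linear[OF bounded_linear_inner_left])
        auto
  qed
qed

lemma Ck_on_local:
  assumes "\<And>x. x \<in> S \<Longrightarrow> \<exists>T. open T \<and> x \<in> T \<and> Ck_on k T f"
  shows "Ck_on k S f"
  using assms
proof (induction k arbitrary: f)
  case 0
  show ?case unfolding Ck_on.simps
    by (rule continuous_at_imp_continuous_on) (metis 0 Ck_on.simps(1) continuous_on_eq_continuous_at)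
next
  case (Suc k)
  then show ?case unfolding Ck_on.simps by meson
qed

lemma smooth_on_subset: "smooth_on T f \<Longrightarrow> S \<subseteq> T \<Longrightarrow> smooth_on S f"
  unfolding smooth_on_def using Ck_on_subset by blast

lemma smooth_on_cong: "open S \<Longrightarrow> (\<And>x. x \<in> S \<Longrightarrow> f x = h x) \<Longrightarrow> smooth_on S f \<Longrightarrow> smooth_on S h"
  unfolding smooth_on_def using Ck_on_cong by blast

lemma smooth_on_has_derivative:
  "smooth_on S f \<Longrightarrow> x \<in> S \<Longrightarrow> (f has_derivative frechet_derivative f (at x)) (at x)"
  unfolding smooth_on_def using Ck_on_has_derivative by blast

lemma smooth_on_frechet_derivative:
  "smooth_on S f \<Longrightarrow> smooth_on S (\<lambda>x. frechet_derivative f (at x) v)"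
  unfolding smooth_on_def by (metis Ck_on.simps(2))

lemma smooth_on_bounded_linear:
  "bounded_linear L \<Longrightarrow> open S \<Longrightarrow> smooth_on S f \<Longrightarrow> smooth_on S (\<lambda>x. L (f x))"
  unfolding smooth_on_def using Ck_on_bounded_linear by blast

lemma smooth_on_linear_map: "bounded_linear L \<Longrightarrow> open S \<Longrightarrow> smooth_on S L"
proof -
  assume L: "bounded_linear L" and S: "open S"
  have "Ck_on k S L" for k
  proof (cases k)
    case 0
    then show ?thesis using L by (simp add: linear_continuous_on)
  next
    case (Suc n)
    show ?thesis unfolding Suc
      by (rule Ck_on_SucI[where F = "\<lambda>x. L"])
         (use L S in \<open>auto intro: bounded_linear_imp_has_derivative Ck_on_const\<close>)
  qed
  then show ?thesis by (simp add: smooth_on_def)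
qed

lemma smooth_on_compose:
  fixes F :: "'a::euclidean_space \<Rightarrow> 'b::euclidean_space"
  assumes "open S" "open T" "F ` S \<subseteq> T" "smooth_on S F" "smooth_on T h"
  shows "smooth_on S (\<lambda>x. h (F x))"
  using assms Ck_on_compose unfolding smooth_on_def by blast

lemma smooth_on_local:
  assumes "\<And>x. x \<in> S \<Longrightarrow> \<exists>T. open T \<and> x \<in> T \<and> smooth_on T f"
  shows "smooth_on S f"
  using assms Ck_on_local unfolding smooth_on_def by meson

section \<open>Smooth functions and maps on manifolds\<close>

lemma smooth_atlasD:
  assumes "smooth_atlas A" "(U, \<phi>) \<in> A"
  shows "open U" "open (\<phi> ` U)" "homeomorphism U (\<phi> ` U) \<phi> (inv_into U \<phi>)"
    and "\<And>V \<psi>. (V, \<psi>) \<in> A \<Longrightarrow> smooth_on (\<phi> ` (U \<inter> V)) (\<psi> \<circ> inv_into U \<phi>)"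
proof -
  have "\<forall>(U, \<phi>)\<in>A. open U \<and> open (\<phi> ` U) \<and> homeomorphism U (\<phi> ` U) \<phi> (inv_into U \<phi>)"
    and trans: "\<forall>(U, \<phi>)\<in>A. \<forall>(V, \<psi>)\<in>A. smooth_on (\<phi> ` (U \<inter> V)) (\<psi> \<circ> inv_into U \<phi>)"
    using assms(1) by (simp_all add: smooth_atlas_def)
  from bspec[OF this(1) assms(2)]
  show "open U" "open (\<phi> ` U)" "homeomorphism U (\<phi> ` U) \<phi> (inv_into U \<phi>)" by simp_all
  show "smooth_on (\<phi> ` (U \<inter> V)) (\<psi> \<circ> inv_into U \<phi>)" if "(V, \<psi>) \<in> A" for V \<psi>
    using bspec[OF bspec[OF trans assms(2), unfolded prod.case] that] by simp
qed

lemma smooth_atlas_covers: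
  assumes "smooth_atlas A"
  obtains U \<phi> where "(U, \<phi>) \<in> A" "p \<in> U"
proof -
  have "p \<in> (\<Union>(U, \<phi>)\<in>A. U)" using assms by (simp add: smooth_atlas_def)
  then show ?thesis using that by blast
qed

lemma chart_inv_into:
  assumes "smooth_atlas A" "(U, \<phi>) \<in> A" "y \<in> U"
  shows "inv_into U \<phi> (\<phi> y) = y"
  using homeomorphism_apply1[OF smooth_atlasD(3)[OF assms(1,2)] assms(3)] .

lemma chart_open_image:
  assumes "smooth_atlas A" "(U, \<phi>) \<in> A" "open W"
  shows "open (\<phi> ` (U \<inter> W))"
proof -
  have "openin (top_of_set (\<phi> ` U)) (\<phi> ` (U \<inter> W))"
    using homeomorphism_imp_open_map[OF smooth_atlasD(3)[OF assms(1,2)]] assms(3)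
    by (simp add: openin_open_Int)
  then show ?thesis using smooth_atlasD(2)[OF assms(1,2)] openin_open_trans by blast
qed

lemma smooth_funD:
  "smooth_fun A W f \<Longrightarrow> (U, \<phi>) \<in> A \<Longrightarrow> smooth_on (\<phi> ` (U \<inter> W)) (f \<circ> inv_into U \<phi>)"
  unfolding smooth_fun_def by fast

lemma smooth_funI:
  "(\<And>U \<phi>. (U, \<phi>) \<in> A \<Longrightarrow> smooth_on (\<phi> ` (U \<inter> W)) (f \<circ> inv_into U \<phi>)) \<Longrightarrow> smooth_fun A W f"
  unfolding smooth_fun_def by fast

lemma smooth_fun_subset: "smooth_fun A W f \<Longrightarrow> W' \<subseteq> W \<Longrightarrow> smooth_fun A W' f"
  by (rule smooth_funI) (rule smooth_on_subset[OF smooth_funD], auto)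

lemma smooth_fun_cong:
  assumes "smooth_atlas A" "open W" "smooth_fun A W f" "\<And>y. y \<in> W \<Longrightarrow> f y = h y"
  shows "smooth_fun A W h"
proof (rule smooth_funI)
  fix U \<phi> assume c: "(U, \<phi>) \<in> A"
  show "smooth_on (\<phi> ` (U \<inter> W)) (h \<circ> inv_into U \<phi>)"
    by (rule smooth_on_cong[OF chart_open_image[OF assms(1) c assms(2)] _ smooth_funD[OF assms(3) c]])
       (auto simp: chart_inv_into[OF assms(1) c] assms(4))
qed

lemma smooth_fun_const: "smooth_atlas A \<Longrightarrow> open W \<Longrightarrow> smooth_fun A W (\<lambda>y. c)"
  by (rule smooth_funI) (simp add: comp_def smooth_on_def Ck_on_const chart_open_image)

lemma smooth_fun_bounded_linear:
  assumes "smooth_atlas A" "open W" "bounded_linear L" "smooth_fun A W f"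
  shows "smooth_fun A W (\<lambda>y. L (f y))"
proof (rule smooth_funI)
  fix U \<phi> assume c: "(U, \<phi>) \<in> A"
  show "smooth_on (\<phi> ` (U \<inter> W)) ((\<lambda>y. L (f y)) \<circ> inv_into U \<phi>)"
    using smooth_on_bounded_linear[OF assms(3) chart_open_image[OF assms(1) c assms(2)]
        smooth_funD[OF assms(4) c]] by (simp only: comp_def)
qed

lemma smooth_fun_add:
  assumes "smooth_atlas A" "open W" "smooth_fun A W f" "smooth_fun A W h"
  shows "smooth_fun A W (\<lambda>y. f y + h y)"
proof (rule smooth_funI)
  fix U \<phi> assume c: "(U, \<phi>) \<in> A"
  show "smooth_on (\<phi> ` (U \<inter> W)) ((\<lambda>y. f y + h y) \<circ> inv_into U \<phi>)"
    using smooth_funD[OF assms(3) c] smooth_funD[OF assms(4) c]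
      Ck_on_add[OF chart_open_image[OF assms(1) c assms(2)]]
    unfolding smooth_on_def comp_def by blast
qed

lemma smooth_fun_mult:
  fixes f h :: "_ \<Rightarrow> real"
  assumes "smooth_atlas A" "open W" "smooth_fun A W f" "smooth_fun A W h"
  shows "smooth_fun A W (\<lambda>y. f y * h y)"
proof (rule smooth_funI)
  fix U \<phi> assume c: "(U, \<phi>) \<in> A"
  show "smooth_on (\<phi> ` (U \<inter> W)) ((\<lambda>y. f y * h y) \<circ> inv_into U \<phi>)"
    using smooth_funD[OF assms(3) c] smooth_funD[OF assms(4) c]
      Ck_on_scaleR[OF chart_open_image[OF assms(1) c assms(2)], where 'b = real]
    unfolding smooth_on_def comp_def real_scaleR_def by blast
qed

lemma smooth_fun_inverse:
  fixes f :: "_ \<Rightarrow> real"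
  assumes "smooth_atlas A" "open W" "smooth_fun A W f" "\<And>y. y \<in> W \<Longrightarrow> f y \<noteq> 0"
  shows "smooth_fun A W (\<lambda>y. inverse (f y))"
proof (rule smooth_funI)
  fix U \<phi> assume c: "(U, \<phi>) \<in> A"
  show "smooth_on (\<phi> ` (U \<inter> W)) ((\<lambda>y. inverse (f y)) \<circ> inv_into U \<phi>)"
    using smooth_funD[OF assms(3) c] unfolding comp_def smooth_on_def
    by (auto intro!: Ck_on_inverse chart_open_image[OF assms(1) c assms(2)]
        simp: chart_inv_into[OF assms(1) c] assms(4))
qed

lemma smooth_fun_sum:
  assumes "smooth_atlas A" "open W" "\<And>i. i \<in> J \<Longrightarrow> smooth_fun A W (f i)"
  shows "smooth_fun A W (\<lambda>y. \<Sum>i\<in>J. f i y)"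
  using assms(3)
  by (induction J rule: infinite_finite_induct) (auto intro!: smooth_fun_const smooth_fun_add assms(1,2))

lemma smooth_fun_prod:
  fixes f :: "_ \<Rightarrow> _ \<Rightarrow> real"
  assumes "smooth_atlas A" "open W" "\<And>i. i \<in> J \<Longrightarrow> smooth_fun A W (f i)"
  shows "smooth_fun A W (\<lambda>y. \<Prod>i\<in>J. f i y)"
  using assms(3)
  by (induction J rule: infinite_finite_induct) (auto intro!: smooth_fun_const smooth_fun_mult assms(1,2))

lemma smooth_fun_det:
  fixes M :: "_ \<Rightarrow> real^'n^'n"
  assumes "smooth_atlas A" "open W" "\<And>i j. smooth_fun A W (\<lambda>y. M y $ i $ j)"
  shows "smooth_fun A W (\<lambda>y. det (M y))"
  unfolding det_def
  by (intro smooth_fun_sum smooth_fun_mult smooth_fun_prod smooth_fun_const assms)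

lemma smooth_fun_continuous_on:
  assumes "smooth_atlas A" "open W" "smooth_fun A W f"
  shows "continuous_on W f"
proof (rule continuous_at_imp_continuous_on, rule ballI)
  fix p assume p: "p \<in> W"
  obtain U \<phi> where c: "(U, \<phi>) \<in> A" and pU: "p \<in> U" using smooth_atlas_covers[OF assms(1)] .
  have "continuous_on (\<phi> ` (U \<inter> W)) (f \<circ> inv_into U \<phi>)"
    using smooth_funD[OF assms(3) c] unfolding smooth_on_def by (metis Ck_on.simps(1))
  moreover have "continuous_on (U \<inter> W) \<phi>"
    by (rule continuous_on_subset[OF homeomorphism_cont1[OF smooth_atlasD(3)[OF assms(1) c]] Int_lower1])
  ultimately have "continuous_on (U \<inter> W) ((f \<circ> inv_into U \<phi>) \<circ> \<phi>)"
    using continuous_on_compose by blast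
  then have "continuous_on (U \<inter> W) f"
    by (rule continuous_on_eq) (simp add: chart_inv_into[OF assms(1) c])
  moreover have "open (U \<inter> W)" using smooth_atlasD(1)[OF assms(1) c] assms(2) by blast
  ultimately show "isCont f p" using p pU continuous_on_eq_continuous_at by blast
qed

text \<open>Transition maps are smooth, so a smooth expression in one chart forces smooth expressions in all.\<close>

lemma smooth_fun_in_chart:
  assumes "smooth_atlas A" "(U, \<phi>) \<in> A" "open W" "W \<subseteq> U" "smooth_on (\<phi> ` W) (f \<circ> inv_into U \<phi>)"
  shows "smooth_fun A W f"
proof (rule smooth_funI)
  fix V \<psi> assume c: "(V, \<psi>) \<in> A"
  have "smooth_on (\<psi> ` (V \<inter> W)) (\<lambda>t. (f \<circ> inv_into U \<phi>) ((\<phi> \<circ> inv_into V \<psi>) t))"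
  proof (rule smooth_on_compose[OF _ _ _ _ assms(5)])
    show "open (\<psi> ` (V \<inter> W))" using chart_open_image[OF assms(1) c assms(3)] .
    show "open (\<phi> ` W)" using chart_open_image[OF assms(1,2,3)] assms(4) by (simp add: Int_absorb1)
    show "(\<phi> \<circ> inv_into V \<psi>) ` \<psi> ` (V \<inter> W) \<subseteq> \<phi> ` W"
      by (auto simp: chart_inv_into[OF assms(1) c])
    show "smooth_on (\<psi> ` (V \<inter> W)) (\<phi> \<circ> inv_into V \<psi>)"
      by (rule smooth_on_subset[OF smooth_atlasD(4)[OF assms(1) c assms(2)]]) (use assms(4) in auto)
  qed
  then show "smooth_on (\<psi> ` (V \<inter> W)) (f \<circ> inv_into V \<psi>)"
    by (rule smooth_on_cong[OF chart_open_image[OF assms(1) c assms(3)], rotated])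
       (use assms(4) in \<open>auto simp: chart_inv_into[OF assms(1) c] chart_inv_into[OF assms(1,2)]\<close>)
qed

lemma smooth_map_open_vimage: "smooth_map A A' F \<Longrightarrow> open S \<Longrightarrow> open (F -` S)"
  unfolding smooth_map_def using continuous_on_open_vimage[OF open_UNIV, of F] by auto

text \<open>Near a point \<open>q\<close> the function \<open>f \<circ> F\<close> factors in charts at \<open>q\<close> and at \<open>F q\<close>, as the expression of \<open>f\<close>
  after the expression of \<open>F\<close>.\<close>

lemma smooth_fun_pullback:
  assumes "smooth_atlas A" "smooth_atlas A'" "smooth_map A A' F" "open W" "smooth_fun A' W f"
  shows "smooth_fun A (F -` W) (f \<circ> F)"
proof (rule smooth_funI, rule smooth_on_local)
  fix U \<phi> t assume c: "(U, \<phi>) \<in> A" and "t \<in> \<phi> ` (U \<inter> F -` W)"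
  then obtain q where q: "q \<in> U" "F q \<in> W" "t = \<phi> q" by blast
  obtain V \<psi> where d: "(V, \<psi>) \<in> A'" "F q \<in> V" using smooth_atlas_covers[OF assms(2)] .
  note F = smooth_map_open_vimage[OF assms(3)]
  have VW: "open (V \<inter> W)" using smooth_atlasD(1)[OF assms(2) d(1)] assms(4) by blast
  let ?T = "\<phi> ` (U \<inter> F -` (V \<inter> W))"
  have T: "open ?T" using chart_open_image[OF assms(1) c F[OF VW]] .
  have "smooth_on ?T (\<lambda>t. (f \<circ> inv_into V \<psi>) ((\<psi> \<circ> F \<circ> inv_into U \<phi>) t))"
  proof (rule smooth_on_compose[OF T _ _ _ smooth_funD[OF assms(5) d(1)]])
    show "open (\<psi> ` (V \<inter> W))" using chart_open_image[OF assms(2) d(1) assms(4)] .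
    show "(\<psi> \<circ> F \<circ> inv_into U \<phi>) ` ?T \<subseteq> \<psi> ` (V \<inter> W)"
      by (auto simp: chart_inv_into[OF assms(1) c])
    have "smooth_on (\<phi> ` (U \<inter> F -` V)) (\<psi> \<circ> F \<circ> inv_into U \<phi>)"
      using assms(3) c d(1) unfolding smooth_map_def by fast
    then show "smooth_on ?T (\<psi> \<circ> F \<circ> inv_into U \<phi>)" by (rule smooth_on_subset) auto
  qed
  then have "smooth_on ?T (f \<circ> F \<circ> inv_into U \<phi>)"
    by (rule smooth_on_cong[OF T, rotated])
       (auto simp: chart_inv_into[OF assms(1) c] chart_inv_into[OF assms(2) d(1)])
  moreover have "t \<in> ?T" using q d(2) by blast
  ultimately show "\<exists>T. open T \<and> t \<in> T \<and> smooth_on T (f \<circ> F \<circ> inv_into U \<phi>)" using T by blast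
qed

lemma continuous_on_map_prod:
  "continuous_on X a \<Longrightarrow> continuous_on Y b \<Longrightarrow> continuous_on (X \<times> Y) (map_prod a b)"
  unfolding map_prod_def case_prod_beta
  by (intro continuous_on_Pair continuous_on_compose2[OF _ continuous_on_fst[OF continuous_on_id], of X a]
      continuous_on_compose2[OF _ continuous_on_snd[OF continuous_on_id], of Y b]) auto

lemma homeomorphism_map_prod:
  assumes "homeomorphism S S' f f'" "homeomorphism T T' h h'"
  shows "homeomorphism (S \<times> T) (S' \<times> T') (map_prod f h) (map_prod f' h')"
  using assms by (intro homeomorphismI) (auto simp: homeomorphism_def intro: continuous_on_map_prod)

text \<open>The differential of the orbit map defines the generated vector fields, whereas smoothness of
  the action concerns the product atlas.  The slice \<open>h \<mapsto> (h, x)\<close> has to be read in product charts.\<close>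

lemma orbit_map_smooth:
  assumes "smooth_atlas AG" "smooth_atlas A" "smooth_map (prod_atlas AG A) A (\<lambda>(h, x). act h x)"
  shows "smooth_map AG A (\<lambda>h. act h x)"
proof -
  let ?F = "\<lambda>(h, x). act h x"
  have "continuous_on UNIV (?F \<circ> (\<lambda>h. (h, x)))"
  proof (rule continuous_on_compose)
    show "continuous_on UNIV (\<lambda>h. (h, x))" by (intro continuous_intros)
    show "continuous_on (range (\<lambda>h. (h, x))) ?F"
      using assms(3) continuous_on_subset unfolding smooth_map_def by blast
  qed
  then have cont: "continuous_on UNIV (\<lambda>h. act h x)" by (simp add: comp_def)
  moreover have "smooth_on (\<phi> ` (U \<inter> (\<lambda>h. act h x) -` V)) (\<psi> \<circ> (\<lambda>h. act h x) \<circ> inv_into U \<phi>)"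
    if c: "(U, \<phi>) \<in> AG" and d: "(V, \<psi>) \<in> A" for U \<phi> V \<psi>
  proof -
    obtain W \<theta> where w: "(W, \<theta>) \<in> A" "x \<in> W" using smooth_atlas_covers[OF assms(2)] .
    have inv: "inv_into (U \<times> W) (map_prod \<phi> \<theta>) (\<phi> h, \<theta> y) = (h, y)" if "h \<in> U" "y \<in> W" for h y
    proof -
      have "inj_on \<phi> U" "inj_on \<theta> W"
        using chart_inv_into[OF assms(1) c] chart_inv_into[OF assms(2) w(1)] by (metis inj_onI)+
      then have "inj_on (map_prod \<phi> \<theta>) (U \<times> W)" by (rule map_prod_inj_on)
      from inv_into_f_f[OF this, of "(h, y)"] that show ?thesis by simp
    qed
    let ?S = "\<phi> ` (U \<inter> (\<lambda>h. act h x) -` V)"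
    let ?T = "map_prod \<phi> \<theta> ` ((U \<times> W) \<inter> ?F -` V)"
    have V: "open V" "open U" "open W"
      using smooth_atlasD(1) assms(1,2) c d w(1) by blast+
    have "open ((\<lambda>h. act h x) -` V)"
      using cont V(1) continuous_on_open_vimage[OF open_UNIV] by auto
    then have S: "open ?S" by (rule chart_open_image[OF assms(1) c])
    have hom: "homeomorphism (U \<times> W) (\<phi> ` U \<times> \<theta> ` W) (map_prod \<phi> \<theta>) (map_prod (inv_into U \<phi>) (inv_into W \<theta>))"
      using homeomorphism_map_prod[OF smooth_atlasD(3)[OF assms(1) c] smooth_atlasD(3)[OF assms(2) w(1)]] .
    have "open (?F -` V)" using smooth_map_open_vimage[OF assms(3) V(1)] .
    then have "openin (top_of_set (\<phi> ` U \<times> \<theta> ` W)) ?T"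
      using homeomorphism_imp_open_map[OF hom] by (simp add: openin_open_Int)
    then have T: "open ?T"
      using smooth_atlasD(2)[OF assms(1) c] smooth_atlasD(2)[OF assms(2) w(1)]
      by (rule openin_open_trans[OF _ open_Times])
    have "(U \<times> W, map_prod \<phi> \<theta>) \<in> prod_atlas AG A"
      using c w(1) unfolding prod_atlas_def by blast
    then have FT: "smooth_on ?T (\<psi> \<circ> ?F \<circ> inv_into (U \<times> W) (map_prod \<phi> \<theta>))"
      using assms(3) d unfolding smooth_map_def by fast
    \<comment> \<open>In coordinates the orbit map is the action composed with an affine map.\<close>
    have "smooth_on ?S (\<lambda>t. (\<psi> \<circ> ?F \<circ> inv_into (U \<times> W) (map_prod \<phi> \<theta>)) ((t, 0) + (0, \<theta> x)))"
    proof (rule smooth_on_compose[OF S T _ _ FT])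
      show "(\<lambda>t. (t, 0) + (0, \<theta> x)) ` ?S \<subseteq> ?T" using w(2) by (auto simp: image_iff)
      show "smooth_on ?S (\<lambda>t. (t, 0) + (0, \<theta> x))"
        unfolding smooth_on_def
        by (intro allI Ck_on_add[OF S] Ck_on_const[OF S]
            smooth_on_linear_map[OF bounded_linear_Pair[OF bounded_linear_ident bounded_linear_zero] S,
              unfolded smooth_on_def, rule_format])
    qed
    then show ?thesis
      by (rule smooth_on_cong[OF S, rotated]) (auto simp: inv[OF _ w(2)] chart_inv_into[OF assms(1) c])
  qed
  ultimately show ?thesis unfolding smooth_map_def by fast
qed

section \<open>Tangent vectors and vector fields\<close>

lemma smooth_nearI: "open W \<Longrightarrow> p \<in> W \<Longrightarrow> smooth_fun A W f \<Longrightarrow> smooth_near A p f"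
  unfolding smooth_near_def by blast

lemma smooth_near_const: "smooth_atlas A \<Longrightarrow> smooth_near A p (\<lambda>y. c)"
  by (rule smooth_nearI[of UNIV]) (auto intro: smooth_fun_const)

lemma smooth_near_add_mult:
  assumes "smooth_atlas A" "smooth_near A p f" "smooth_near A p h"
  shows "smooth_near A p (\<lambda>y. f y + h y)" "smooth_near A p (\<lambda>y. f y * h y)"
proof -
  obtain W W' where "open W" "p \<in> W" "smooth_fun A W f" "open W'" "p \<in> W'" "smooth_fun A W' h"
    using assms(2,3) unfolding smooth_near_def by blast
  then have W: "open (W \<inter> W')" "p \<in> W \<inter> W'" "smooth_fun A (W \<inter> W') f" "smooth_fun A (W \<inter> W') h"
    by (auto intro: smooth_fun_subset)
  show "smooth_near A p (\<lambda>y. f y + h y)" "smooth_near A p (\<lambda>y. f y * h y)"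
    using W by (blast intro: smooth_nearI smooth_fun_add smooth_fun_mult assms(1))+
qed

lemma smooth_near_sum:
  assumes "smooth_atlas A" "\<And>i. i \<in> J \<Longrightarrow> smooth_near A p (f i)"
  shows "smooth_near A p (\<lambda>y. \<Sum>i\<in>J. f i y)"
  using assms(2)
  by (induction J rule: infinite_finite_induct)
     (auto intro!: smooth_near_const smooth_near_add_mult(1) assms(1))

lemma smooth_near_cong:
  assumes "smooth_atlas A" "smooth_near A p f" "eventually (\<lambda>y. f y = h y) (nhds p)"
  shows "smooth_near A p h"
proof -
  obtain W W' where "open W" "p \<in> W" "smooth_fun A W f" "open W'" "p \<in> W'" "\<And>y. y \<in> W' \<Longrightarrow> f y = h y"
    using assms(2,3) unfolding smooth_near_def eventually_nhds by blast
  then have "open (W \<inter> W')" "p \<in> W \<inter> W'" "smooth_fun A (W \<inter> W') h"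
    using smooth_fun_cong[OF assms(1), of "W \<inter> W'" f h] by (auto intro: smooth_fun_subset)
  then show ?thesis by (rule smooth_nearI)
qed

lemma smooth_near_pullback:
  assumes "smooth_atlas A" "smooth_atlas A'" "smooth_map A A' F" "smooth_near A' (F p) f"
  shows "smooth_near A p (f \<circ> F)"
proof -
  obtain W where W: "open W" "F p \<in> W" "smooth_fun A' W f" using assms(4) unfolding smooth_near_def by blast
  have "open (F -` W)"
    using smooth_map_open_vimage[OF assms(3) W(1)] .
  then show ?thesis using W smooth_fun_pullback[OF assms(1-3) W(1,3)] by (intro smooth_nearI) auto
qed

lemma tangent_cong:
  "v \<in> tangent_space A p \<Longrightarrow> smooth_near A p f \<Longrightarrow> eventually (\<lambda>y. f y = h y) (nhds p) \<Longrightarrow> v f = v h"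
  unfolding tangent_space_def by blast

lemma tangent_add:
  "v \<in> tangent_space A p \<Longrightarrow> smooth_near A p f \<Longrightarrow> smooth_near A p h \<Longrightarrow> v (\<lambda>y. f y + h y) = v f + v h"
  unfolding tangent_space_def by blast

lemma tangent_mult:
  "v \<in> tangent_space A p \<Longrightarrow> smooth_near A p f \<Longrightarrow> smooth_near A p h \<Longrightarrow>
    v (\<lambda>y. f y * h y) = f p * v h + h p * v f"
  unfolding tangent_space_def by blast

lemma tangent_scale:
  "v \<in> tangent_space A p \<Longrightarrow> smooth_near A p f \<Longrightarrow> v (\<lambda>y. c * f y) = c * v f"
  unfolding tangent_space_def by blast

lemma tangent_sum:
  assumes "smooth_atlas A" "v \<in> tangent_space A p" "\<And>i. i \<in> J \<Longrightarrow> smooth_near A p (f i)"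
  shows "v (\<lambda>y. \<Sum>i\<in>J. f i y) = (\<Sum>i\<in>J. v (f i))"
  using assms(3)
proof (induction J rule: infinite_finite_induct)
  case (insert i J)
  then show ?case
    by (simp add: tangent_add[OF assms(2)] smooth_near_sum[OF assms(1)])
qed (use tangent_scale[OF assms(2) smooth_near_const[OF assms(1)], of 0] in auto)

lemma subspace_tangent_space: "subspace (tangent_space A p)"
  unfolding subspace_def tangent_space_def by (auto simp: algebra_simps)

lemmas tangent_space_closed =
  subspace_0[OF subspace_tangent_space] subspace_add[OF subspace_tangent_space]
  subspace_scale[OF subspace_tangent_space] subspace_neg[OF subspace_tangent_space]

text \<open>The Leibniz rule for \<open>f \<mapsto> v (f \<circ> F)\<close> at \<open>F p\<close> is that for \<open>v\<close> at \<open>p\<close>, since \<open>(f \<circ> F) p = f (F p)\<close>; the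
  pullbacks are smooth near \<open>p\<close>, and germs pull back to germs because \<open>F\<close> is continuous.\<close>

lemma pushforward_tangent:
  assumes "smooth_atlas A" "smooth_atlas A'" "smooth_map A A' F" "v \<in> tangent_space A p"
  shows "pushforward A' F p v \<in> tangent_space A' (F p)"
proof -
  have pb: "smooth_near A p (\<lambda>y. f (F y))" if "smooth_near A' (F p) f" for f
    using smooth_near_pullback[OF assms(1-3) that] by (simp add: comp_def)
  have tendsto: "filterlim F (nhds (F p)) (nhds p)"
    using assms(3) unfolding smooth_map_def continuous_on_eq_continuous_at[OF open_UNIV]
    by (simp add: continuous_at isCont_def tendsto_at_iff_tendsto_nhds)
  have germ: "v (\<lambda>y. f (F y)) = v (\<lambda>y. h (F y))"
    if "smooth_near A' (F p) f" "eventually (\<lambda>y. f y = h y) (nhds (F p))" for f h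
    using tangent_cong[OF assms(4) pb[OF that(1)] eventually_compose_filterlim[OF that(2) tendsto]] .
  show ?thesis
    unfolding tangent_space_def pushforward_def comp_def
    by (auto simp: smooth_near_add_mult[OF assms(2)] smooth_near_const[OF assms(2)] pb germ
        smooth_near_cong[OF assms(2)] tangent_add[OF assms(4)] tangent_mult[OF assms(4)]
        tangent_scale[OF assms(4)] dest: smooth_near_add_mult(2)[OF assms(2) smooth_near_const[OF assms(2)]])
qed

text \<open>The partial derivative in direction \<open>e\<close> of the chart.  These fields show that tangent spaces, which
  are defined abstractly by derivations, are nonzero; without a nonzero vector no relation between
  the endomorphisms \<open>I\<^sub>i\<close> could be compared coefficientwise.\<close>

definition coordinate_field ::
  "('m::topological_space, 'e::euclidean_space) chart set \<Rightarrow> 'm set \<Rightarrow> ('m \<Rightarrow> 'e) \<Rightarrow> 'e \<Rightarrow> 'm vfield"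
  where "coordinate_field A U \<phi> e y =
    (\<lambda>f. if smooth_near A y f then frechet_derivative (f \<circ> inv_into U \<phi>) (at (\<phi> y)) e else 0)"

lemma smooth_near_has_derivative:
  assumes "smooth_atlas A" "(U, \<phi>) \<in> A" "y \<in> U" "smooth_near A y f"
  shows "((f \<circ> inv_into U \<phi>) has_derivative frechet_derivative (f \<circ> inv_into U \<phi>) (at (\<phi> y))) (at (\<phi> y))"
proof -
  obtain W where W: "open W" "y \<in> W" "smooth_fun A W f" using assms(4) unfolding smooth_near_def by blast
  show ?thesis
    by (rule smooth_on_has_derivative[OF smooth_funD[OF W(3) assms(2)]]) (use W assms(3) in blast)
qed

lemma coordinate_field_tangent:
  assumes "smooth_atlas A" "(U, \<phi>) \<in> A" "y \<in> U"
  shows "coordinate_field A U \<phi> e y \<in> tangent_space A y"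
proof -
  let ?D = "\<lambda>f. frechet_derivative (f \<circ> inv_into U \<phi>) (at (\<phi> y))"
  note d = smooth_near_has_derivative[OF assms]
  note inv = chart_inv_into[OF assms]
  have D: "?D f = f'" if "((f \<circ> inv_into U \<phi>) has_derivative f') (at (\<phi> y))" for f f'
    using frechet_derivative_at[OF that] by simp
  have germ: "?D f = ?D h" if f: "smooth_near A y f" and "eventually (\<lambda>y. f y = h y) (nhds y)" for f h
  proof -
    obtain W where W: "open W" "y \<in> W" "\<And>z. z \<in> W \<Longrightarrow> f z = h z"
      using \<open>eventually _ _\<close> unfolding eventually_nhds by blast
    have "((h \<circ> inv_into U \<phi>) has_derivative ?D f) (at (\<phi> y))"
      by (rule has_derivative_transform_within_open[OF d[OF f] chart_open_image[OF assms(1,2) W(1)]])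
         (use W assms(3) chart_inv_into[OF assms(1,2)] in auto)
    then show ?thesis using D by metis
  qed
  have add: "?D (\<lambda>y. f y + h y) e = ?D f e + ?D h e" if "smooth_near A y f" "smooth_near A y h" for f h
  proof -
    have "((\<lambda>y. f y + h y) \<circ> inv_into U \<phi> has_derivative (\<lambda>e. ?D f e + ?D h e)) (at (\<phi> y))"
      using has_derivative_add[OF d[OF that(1)] d[OF that(2)]] by (simp add: comp_def)
    from D[OF this] show ?thesis by simp
  qed
  have mult: "?D (\<lambda>y. f y * h y) e = f y * ?D h e + h y * ?D f e"
    if "smooth_near A y f" "smooth_near A y h" for f h :: "_ \<Rightarrow> real"
  proof -
    have "((\<lambda>y. f y * h y) \<circ> inv_into U \<phi> has_derivative (\<lambda>e. f y * ?D h e + ?D f e * h y)) (at (\<phi> y))"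
      using has_derivative_mult[OF d[OF that(1)] d[OF that(2)]] by (simp add: comp_def inv)
    from D[OF this] show ?thesis by simp
  qed
  have scale: "?D (\<lambda>y. c * f y) e = c * ?D f e" if "smooth_near A y f" for c f
  proof -
    have "((\<lambda>y. c * f y) \<circ> inv_into U \<phi> has_derivative (\<lambda>e. c * ?D f e)) (at (\<phi> y))"
      using has_derivative_mult_right[OF d[OF that], of c] by (simp add: comp_def)
    from D[OF this] show ?thesis by simp
  qed
  have sc: "smooth_near A y (\<lambda>y. c * f y)" if "smooth_near A y f" for c f
    using smooth_near_add_mult(2)[OF assms(1) smooth_near_const[OF assms(1)] that] .
  show ?thesis
    unfolding tangent_space_def coordinate_field_def
    by (auto simp: smooth_near_add_mult[OF assms(1)] sc add mult scale germ
        dest: smooth_near_cong[OF assms(1)])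
qed

lemma coordinate_field_smooth:
  assumes "smooth_atlas A" "(U, \<phi>) \<in> A"
  shows "smooth_vfield A U (coordinate_field A U \<phi> e)"
  unfolding smooth_vfield_def
proof (intro conjI ballI allI impI)
  fix W and f :: "_ \<Rightarrow> real" assume W: "open W \<and> W \<subseteq> U \<and> smooth_fun A W f"
  have WU: "U \<inter> W = W" using W by blast
  have oW: "open (\<phi> ` W)" using chart_open_image[OF assms] W WU by metis
  have "smooth_on (\<phi> ` W) (\<lambda>t. frechet_derivative (f \<circ> inv_into U \<phi>) (at t) e)"
    using smooth_on_frechet_derivative[OF smooth_funD[of A W f, OF _ assms(2)]] W WU by metis
  then have "smooth_on (\<phi> ` W) ((\<lambda>y. coordinate_field A U \<phi> e y f) \<circ> inv_into U \<phi>)"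
    by (rule smooth_on_cong[OF oW, rotated])
       (use W chart_inv_into[OF assms] in \<open>auto simp: coordinate_field_def smooth_near_def subset_iff\<close>)
  then show "smooth_fun A W (\<lambda>y. coordinate_field A U \<phi> e y f)"
    using W by (intro smooth_fun_in_chart[OF assms]) auto
qed (rule coordinate_field_tangent[OF assms])

text \<open>On the coordinate function \<open>z \<mapsto> \<langle>\<phi> z, e\<rangle>\<close> the field takes the value \<open>\<langle>e, e\<rangle>\<close>.\<close>

lemma coordinate_field_nonzero:
  assumes "smooth_atlas A" "(U, \<phi>) \<in> A" "y \<in> U" "e \<noteq> 0"
  shows "coordinate_field A U \<phi> e y \<noteq> 0"
proof -
  let ?f = "\<lambda>z. \<phi> z \<bullet> e"
  have o: "open (\<phi> ` U)" "open U" using smooth_atlasD(1,2)[OF assms(1,2)] by auto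
  have inv: "\<phi> (inv_into U \<phi> t) = t" if "t \<in> \<phi> ` U" for t using that by (simp add: f_inv_into_f)
  have "smooth_on (\<phi> ` U) (?f \<circ> inv_into U \<phi>)"
    by (rule smooth_on_cong[OF o(1) _ smooth_on_linear_map[OF bounded_linear_inner_left[of e] o(1)]])
       (simp add: inv)
  then have near: "smooth_near A y ?f"
    using smooth_fun_in_chart[OF assms(1,2) o(2)] assms(3) o(2) by (intro smooth_nearI[of U]) auto
  have "((?f \<circ> inv_into U \<phi>) has_derivative (\<lambda>v. v \<bullet> e)) (at (\<phi> y))"
    by (rule has_derivative_transform_within_open[OF _ o(1),
          OF bounded_linear_imp_has_derivative[OF bounded_linear_inner_left]])
       (use assms(3) inv in auto)
  then have "coordinate_field A U \<phi> e y ?f = e \<bullet> e"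
    using frechet_derivative_at near unfolding coordinate_field_def by metis
  then show ?thesis using assms(4) by (metis inner_eq_zero_iff zero_fun_def)
qed

lemma exists_nonvanishing_vfield:
  fixes A :: "('m::{t2_space, second_countable_topology}, 'e::euclidean_space) chart set"
  assumes "smooth_atlas A"
  obtains W Z where "open W" "p \<in> W" "smooth_vfield A W Z" "Z p \<noteq> 0"
proof -
  obtain U \<phi> where c: "(U, \<phi>) \<in> A" "p \<in> U" using smooth_atlas_covers[OF assms] .
  obtain e :: 'e where "e \<in> Basis" using nonempty_Basis by blast
  then have "e \<noteq> 0" using nonzero_Basis by blast
  with c show ?thesis
    using that[of U "coordinate_field A U \<phi> e"] smooth_atlasD(1) coordinate_field_smooth
      coordinate_field_nonzero assms by blast
qed

lemma smooth_vfield_tangent: "smooth_vfield A U Z \<Longrightarrow> y \<in> U \<Longrightarrow> Z y \<in> tangent_space A y"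
  by (simp add: smooth_vfield_def)

lemma smooth_vfield_smooth_fun:
  "smooth_vfield A U Z \<Longrightarrow> open W \<Longrightarrow> W \<subseteq> U \<Longrightarrow> smooth_fun A W f \<Longrightarrow> smooth_fun A W (\<lambda>y. Z y f)"
  by (simp add: smooth_vfield_def)

lemma smooth_vfieldI:
  assumes "\<And>y. y \<in> U \<Longrightarrow> Z y \<in> tangent_space A y"
    and "\<And>W f. open W \<Longrightarrow> W \<subseteq> U \<Longrightarrow> smooth_fun A W f \<Longrightarrow> smooth_fun A W (\<lambda>y. Z y f)"
  shows "smooth_vfield A U Z"
  using assms by (simp add: smooth_vfield_def)

lemma smooth_vfield_subset:
  assumes "smooth_vfield A U Z" "U' \<subseteq> U"
  shows "smooth_vfield A U' Z"
  by (rule smooth_vfieldI)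
     (use smooth_vfield_tangent[OF assms(1)] smooth_vfield_smooth_fun[OF assms(1)] assms(2) in auto)

lemma smooth_vfield_add:
  assumes "smooth_atlas A" "smooth_vfield A U Z" "smooth_vfield A U Z'"
  shows "smooth_vfield A U (\<lambda>y. Z y + Z' y)"
proof (rule smooth_vfieldI)
  show "Z y + Z' y \<in> tangent_space A y" if "y \<in> U" for y
    using that assms(2,3)[THEN smooth_vfield_tangent] by (simp add: tangent_space_closed)
  show "smooth_fun A W (\<lambda>y. (Z y + Z' y) f)" if "open W" "W \<subseteq> U" "smooth_fun A W f" for W f
    using smooth_fun_add[OF assms(1) that(1) assms(2,3)[THEN smooth_vfield_smooth_fun, OF that]]
    by simp
qed

lemma smooth_vfield_scale:
  assumes "smooth_atlas A" "smooth_vfield A U Z" "smooth_fun A U f"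
  shows "smooth_vfield A U (\<lambda>y. f y *\<^sub>R Z y)"
proof (rule smooth_vfieldI)
  show "f y *\<^sub>R Z y \<in> tangent_space A y" if "y \<in> U" for y
    using that assms(2)[THEN smooth_vfield_tangent] by (simp add: tangent_space_closed)
  show "smooth_fun A W (\<lambda>y. (f y *\<^sub>R Z y) h)" if "open W" "W \<subseteq> U" "smooth_fun A W h" for W h
    using smooth_fun_mult[OF assms(1) that(1) smooth_fun_subset[OF assms(3) that(2)]
        smooth_vfield_smooth_fun[OF assms(2) that]] by simp
qed

section \<open>Riemannian metrics and quaternionic frames at a point\<close>

lemma metric_sym:
  "riemannian_metric A g \<Longrightarrow> v \<in> tangent_space A p \<Longrightarrow> w \<in> tangent_space A p \<Longrightarrow> g p v w = g p w v"
  by (simp add: riemannian_metric_def)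

lemma metric_add_right:
  "riemannian_metric A g \<Longrightarrow> v \<in> tangent_space A p \<Longrightarrow> w \<in> tangent_space A p \<Longrightarrow>
    w' \<in> tangent_space A p \<Longrightarrow> g p v (w + w') = g p v w + g p v w'"
  by (simp add: riemannian_metric_def lin_on_def)

lemma metric_scale_right:
  "riemannian_metric A g \<Longrightarrow> v \<in> tangent_space A p \<Longrightarrow> w \<in> tangent_space A p \<Longrightarrow>
    g p v (c *\<^sub>R w) = c * g p v w"
  by (simp add: riemannian_metric_def lin_on_def)

lemma metric_minus_right:
  "riemannian_metric A g \<Longrightarrow> v \<in> tangent_space A p \<Longrightarrow> w \<in> tangent_space A p \<Longrightarrow>
    g p v (- w) = - g p v w"
  using metric_scale_right[of A g v p w "-1"] by simp

lemma metric_minus_left: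
  "riemannian_metric A g \<Longrightarrow> v \<in> tangent_space A p \<Longrightarrow> w \<in> tangent_space A p \<Longrightarrow>
    g p (- v) w = - g p v w"
  by (metis metric_minus_right metric_sym tangent_space_closed(4))

lemma metric_eq_zero:
  "riemannian_metric A g \<Longrightarrow> v \<in> tangent_space A p \<Longrightarrow> g p v v = 0 \<Longrightarrow> v = 0"
  by (metis riemannian_metric_def order_less_irrefl)

lemma numeral_3_reduce: "(4::3) = 1" "(5::3) = 2"
  by simp_all

context
  fixes A :: "('m::topological_space, 'e::euclidean_space) chart set" and g Q U I y
  assumes rm: "riemannian_metric A g" and frame: "quaternionic_frame A g Q U I" and y: "y \<in> U"
begin

lemma frame_endo: "I i y \<in> endos A y"
  using frame y by (simp add: quaternionic_frame_def smooth_endo_def)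

lemma frame_tangent: "z \<in> tangent_space A y \<Longrightarrow> I i y z \<in> tangent_space A y"
  using frame_endo unfolding endos_def by blast

lemma frame_add:
  "z \<in> tangent_space A y \<Longrightarrow> w \<in> tangent_space A y \<Longrightarrow> I i y (z + w) = I i y z + I i y w"
  using frame_endo[of i] by (simp add: endos_def lin_on_def)

lemma frame_scale: "z \<in> tangent_space A y \<Longrightarrow> I i y (c *\<^sub>R z) = c *\<^sub>R I i y z"
  using frame_endo[of i] by (simp add: endos_def lin_on_def)

lemma frame_square: "z \<in> tangent_space A y \<Longrightarrow> I i y (I i y z) = - z"
  using frame y by (simp add: quaternionic_frame_def)

lemma frame_isometry:
  "z \<in> tangent_space A y \<Longrightarrow> w \<in> tangent_space A y \<Longrightarrow> g y (I i y z) (I i y w) = g y z w"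
  using frame y by (simp add: quaternionic_frame_def)

lemma frame_cyclic:
  assumes "z \<in> tangent_space A y"
  shows "I 1 y (I 2 y z) = I 3 y z" "I 2 y (I 3 y z) = I 1 y z" "I 3 y (I 1 y z) = I 2 y z"
proof -
  have "I i y (I (i + 1) y z) = I (i + 2) y z" for i
    using frame y assms by (simp add: quaternionic_frame_def)
  from this[of 1] this[of 2] this[of 3]
  show "I 1 y (I 2 y z) = I 3 y z" "I 2 y (I 3 y z) = I 1 y z" "I 3 y (I 1 y z) = I 2 y z"
    by (simp_all add: numeral_3_reduce)
qed

lemma frame_anticyclic:
  assumes "z \<in> tangent_space A y"
  shows "I 2 y (I 1 y z) = - I 3 y z" "I 3 y (I 2 y z) = - I 1 y z" "I 1 y (I 3 y z) = - I 2 y z"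
  using frame_square[OF frame_tangent[OF assms, of 1], of 2] frame_square[OF assms]
    frame_cyclic[OF frame_tangent[OF assms]] frame_cyclic[OF assms] frame_tangent[OF assms]
  by (metis frame_square)+

lemma frame_skew:
  assumes "z \<in> tangent_space A y" "w \<in> tangent_space A y"
  shows "g y (I i y z) w = - g y z (I i y w)"
proof -
  have "g y (I i y z) w = g y (I i y (I i y z)) (I i y w)"
    by (simp add: frame_isometry frame_tangent assms)
  then show ?thesis
    by (simp add: frame_square assms metric_minus_left[OF rm] frame_tangent)
qed

lemma frame_orthogonal_self:
  assumes "z \<in> tangent_space A y"
  shows "g y z (I i y z) = 0"
  using frame_skew[OF assms assms, of i] metric_sym[OF rm assms frame_tangent[OF assms, of i]] by simp

lemma frame_orthogonal:
  assumes z: "z \<in> tangent_space A y" and "i \<noteq> j"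
  shows "g y (I i y z) (I j y z) = 0"
proof -
  have "\<exists>k. I i y (I j y z) = I k y z \<or> I i y (I j y z) = - I k y z"
    using frame_cyclic[OF z] frame_anticyclic[OF z] \<open>i \<noteq> j\<close> exhaust_3[of i] exhaust_3[of j] by metis
  then have "g y z (I i y (I j y z)) = 0"
    using frame_orthogonal_self[OF z] metric_minus_right[OF rm z frame_tangent[OF z]] by force
  then show ?thesis using frame_skew[OF z frame_tangent[OF z]] by simp
qed

text \<open>Since the \<open>I\<^sub>i\<close> are isometric and skew, \<open>z, I\<^sub>1 z, I\<^sub>2 z, I\<^sub>3 z\<close> are pairwise orthogonal vectors of
  the same length.\<close>

lemma frame_independent:
  assumes z: "z \<in> tangent_space A y" "z \<noteq> 0"
    and "c1 *\<^sub>R I 1 y z + c2 *\<^sub>R I 2 y z + c3 *\<^sub>R I 3 y z + d *\<^sub>R z = 0"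
  shows "c1 = 0" "c2 = 0" "c3 = 0" "d = 0"
proof -
  let ?u = "c1 *\<^sub>R I 1 y z + c2 *\<^sub>R I 2 y z + c3 *\<^sub>R I 3 y z + d *\<^sub>R z"
  note T = frame_tangent[OF z(1)]
  have expand: "g y w ?u = c1 * g y w (I 1 y z) + c2 * g y w (I 2 y z) + c3 * g y w (I 3 y z) + d * g y w z"
    if "w \<in> tangent_space A y" for w
    using that z(1) T by (simp add: metric_add_right[OF rm] metric_scale_right[OF rm] tangent_space_closed)
  have zero: "g y w ?u = 0" if "w \<in> tangent_space A y" for w
    using metric_scale_right[OF rm that that, of 0] assms(3) by simp
  have pos: "g y z z \<noteq> 0" using metric_eq_zero[OF rm] z by blast
  have orth: "g y (I i y z) z = 0" for i
    using frame_orthogonal_self[OF z(1)] metric_sym[OF rm] z(1) T by metis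
  show "c1 = 0" "c2 = 0" "c3 = 0" "d = 0"
    using expand[OF T[of 1]] expand[OF T[of 2]] expand[OF T[of 3]] expand[OF z(1)]
      zero[OF T] zero[OF z(1)] pos
    by (simp_all add: orth frame_orthogonal[OF z(1)] frame_orthogonal_self[OF z(1)] frame_isometry z(1))
qed

end

lemma span_range_sum:
  fixes f :: "'n::finite \<Rightarrow> 'a::real_vector"
  assumes "u \<in> span (range f)"
  shows "\<exists>c. u = (\<Sum>i\<in>UNIV. c i *\<^sub>R f i)"
proof -
  have "range f \<subseteq> range (\<lambda>c. \<Sum>i\<in>UNIV. c i *\<^sub>R f i)"
  proof
    fix u assume "u \<in> range f"
    then obtain j where "u = f j" by blast
    then show "u \<in> range (\<lambda>c. \<Sum>i\<in>UNIV. c i *\<^sub>R f i)"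
      by (intro range_eqI[of _ _ "\<lambda>i. if i = j then 1 else 0"])
        (simp add: if_distrib[of "\<lambda>c. c *\<^sub>R _"] cong: if_cong)
  qed
  moreover have "subspace (range (\<lambda>c. \<Sum>i\<in>UNIV. c i *\<^sub>R f i))"
    unfolding subspace_def
  proof (intro conjI ballI allI)
    show "0 \<in> range (\<lambda>c. \<Sum>i\<in>UNIV. c i *\<^sub>R f i)" by (rule range_eqI[of _ _ "\<lambda>_. 0"]) simp
  next
    fix a b assume "a \<in> range (\<lambda>c. \<Sum>i\<in>UNIV. c i *\<^sub>R f i)" "b \<in> range (\<lambda>c. \<Sum>i\<in>UNIV. c i *\<^sub>R f i)"
    then obtain c d where "a = (\<Sum>i\<in>UNIV. c i *\<^sub>R f i)" "b = (\<Sum>i\<in>UNIV. d i *\<^sub>R f i)" by blast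
    then show "a + b \<in> range (\<lambda>c. \<Sum>i\<in>UNIV. c i *\<^sub>R f i)"
      by (intro range_eqI[of _ _ "\<lambda>i. c i + d i"]) (simp add: scaleR_left_distrib sum.distrib)
  next
    fix r a assume "a \<in> range (\<lambda>c. \<Sum>i\<in>UNIV. c i *\<^sub>R f i)"
    then obtain c where "a = (\<Sum>i\<in>UNIV. c i *\<^sub>R f i)" by blast
    then show "r *\<^sub>R a \<in> range (\<lambda>c. \<Sum>i\<in>UNIV. c i *\<^sub>R f i)"
      by (intro range_eqI[of _ _ "\<lambda>i. r * c i"]) (simp add: scaleR_sum_right)
  qed
  ultimately have "span (range f) \<subseteq> range (\<lambda>c. \<Sum>i\<in>UNIV. c i *\<^sub>R f i)" by (rule span_minimal)
  with assms show ?thesis by blast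
qed

lemma fun_sum_apply: "(\<Sum>i\<in>S. f i) z = (\<Sum>i\<in>S. f i z)"
  for f :: "_ \<Rightarrow> _ \<Rightarrow> 'b::ab_group_add"
  by (induction S rule: infinite_finite_induct) auto

text \<open>If \<open>I'\<^sub>i = \<Sum>\<^sub>j M\<^sub>i\<^sub>j I\<^sub>j\<close>, then \<open>I'\<^sub>1 I'\<^sub>2 = I'\<^sub>3\<close> says that the third row of \<open>M\<close> is the cross product of
  the first two, so \<open>det M\<close> is the squared length of that row.\<close>

lemma frame_transition:
  fixes A :: "('m::{t2_space, second_countable_topology}, 'e::euclidean_space) chart set"
  assumes rm: "riemannian_metric A g"
    and f: "quaternionic_frame A g Q U I" "y \<in> U" and f': "quaternionic_frame A g Q U' I'" "y \<in> U'"
    and z: "z \<in> tangent_space A y" "z \<noteq> 0"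
  obtains M :: "real^3^3" where "det M > 0" "\<And>i. I' i y = (\<Sum>j\<in>UNIV. M $ i $ j *\<^sub>R I j y)"
proof -
  have "I' i y \<in> span (range (\<lambda>j. I j y))" for i
    using f f' unfolding quaternionic_frame_def by (metis rangeI span_base)
  then have "\<forall>i. \<exists>c. I' i y = (\<Sum>j\<in>UNIV. c j *\<^sub>R I j y)"
    using span_range_sum by blast
  from choice[OF this] obtain c where c: "\<And>i. I' i y = (\<Sum>j\<in>UNIV. c i j *\<^sub>R I j y)" by blast
  define M :: "real^3^3" where "M = (\<chi> i j. c i j)"
  have M: "I' i y = (\<Sum>j\<in>UNIV. M $ i $ j *\<^sub>R I j y)" for i using c by (simp add: M_def)
  have Mz: "I' i y w = M$i$1 *\<^sub>R I 1 y w + M$i$2 *\<^sub>R I 2 y w + M$i$3 *\<^sub>R I 3 y w" for i w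
    by (simp add: M fun_sum_apply sum_3)
  note T = frame_tangent[OF rm f z(1)]
  note eqs = frame_cyclic[OF rm f z(1)] frame_anticyclic[OF rm f z(1)] frame_square[OF rm f z(1)]
  have "I' 1 y (I' 2 y z) = I' 3 y z" using frame_cyclic(1)[OF rm f' z(1)] .
  then have eq: "(M$1$2 * M$2$3 - M$1$3 * M$2$2 - M$3$1) *\<^sub>R I 1 y z
      + (M$1$3 * M$2$1 - M$1$1 * M$2$3 - M$3$2) *\<^sub>R I 2 y z
      + (M$1$1 * M$2$2 - M$1$2 * M$2$1 - M$3$3) *\<^sub>R I 3 y z
      + (- (M$1$1 * M$2$1 + M$1$2 * M$2$2 + M$1$3 * M$2$3)) *\<^sub>R z = 0"
    by (simp add: Mz frame_add[OF rm f] frame_scale[OF rm f] T tangent_space_closed eqs algebra_simps)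
  have row: "M$3$1 = M$1$2 * M$2$3 - M$1$3 * M$2$2" "M$3$2 = M$1$3 * M$2$1 - M$1$1 * M$2$3"
    "M$3$3 = M$1$1 * M$2$2 - M$1$2 * M$2$1"
    using frame_independent[OF rm f z eq] by simp_all
  have "I' 3 y z \<noteq> 0"
    using frame_square[OF rm f' z(1), of 3] frame_scale[OF rm f' z(1), of 3 0] z(2) by auto
  then have "M$3$1 \<noteq> 0 \<or> M$3$2 \<noteq> 0 \<or> M$3$3 \<noteq> 0" by (auto simp: Mz)
  then have "(M$3$1)\<^sup>2 + (M$3$2)\<^sup>2 + (M$3$3)\<^sup>2 > 0"
    by (metis add_nonneg_pos add_pos_nonneg zero_le_power2 zero_less_power2 add_nonneg_nonneg)
  moreover have "det M = (M$3$1)\<^sup>2 + (M$3$2)\<^sup>2 + (M$3$3)\<^sup>2"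
    unfolding det_3 row by (simp add: power2_eq_square algebra_simps)
  ultimately have "det M > 0" by simp
  from that[OF this M] show ?thesis .
qed

section \<open>Oriented planes and the induced map\<close>

lemma triple_matrix_mult:
  fixes N M :: "real^3^3"
  assumes "\<And>i. b i = (\<Sum>j\<in>UNIV. M $ i $ j *\<^sub>R b' j)" "\<And>i. c i = (\<Sum>j\<in>UNIV. N $ i $ j *\<^sub>R b j)"
  shows "c i = (\<Sum>j\<in>UNIV. (N ** M) $ i $ j *\<^sub>R (b' j :: 'a::real_vector))"
  by (simp add: assms matrix_matrix_mult_def scaleR_sum_right scaleR_sum_left sum_3 algebra_simps)

lemma triple_matrix_one: "(\<Sum>j\<in>UNIV. (mat 1 :: real^3^3) $ i $ j *\<^sub>R b j) = (b i :: 'a::real_vector)"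
  by (simp add: mat_def if_distrib[of "\<lambda>c. c *\<^sub>R _"] cong: if_cong)

lemma matrix_inv_mult:
  fixes M :: "real^'n^'n"
  assumes "det M \<noteq> 0"
  shows "matrix_inv M ** M = mat 1"
proof -
  have "\<exists>N. M ** N = mat 1 \<and> N ** M = mat 1"
    using assms by (simp add: invertible_det_nz[symmetric] invertible_def)
  then show ?thesis unfolding matrix_inv_def by (rule someI2_ex) blast
qed

lemma triple_matrix_inv:
  fixes M :: "real^3^3"
  assumes "det M \<noteq> 0" "\<And>i. b i = (\<Sum>j\<in>UNIV. M $ i $ j *\<^sub>R b' j)"
  shows "b' i = (\<Sum>j\<in>UNIV. matrix_inv M $ i $ j *\<^sub>R (b j :: 'a::real_vector))"
proof -
  have "matrix_inv M ** M = mat 1" using assms(1) by (simp add: matrix_inv_mult)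
  then show ?thesis
    using triple_matrix_mult[of b M b' "\<lambda>i. \<Sum>j\<in>UNIV. matrix_inv M $ i $ j *\<^sub>R b j" "matrix_inv M" i, OF assms(2) refl]
    by (simp add: triple_matrix_one)
qed

lemma det_matrix_inv_pos:
  fixes M :: "real^3^3"
  assumes "det M > 0"
  shows "det (matrix_inv M) > 0"
proof -
  have "matrix_inv M ** M = mat 1" using assms by (simp add: matrix_inv_mult)
  then have "det (matrix_inv M) * det M = 1" by (metis det_I det_mul)
  with assms show ?thesis by (metis zero_less_mult_pos2 zero_less_one)
qed

lemma oriented_span_mono:
  fixes M :: "real^3^3"
  assumes "det M > 0" "\<And>i. b i = (\<Sum>j\<in>UNIV. M $ i $ j *\<^sub>R b' j)"
  shows "oriented_span b \<subseteq> oriented_span (b' :: 3 \<Rightarrow> 'l::real_vector)"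
proof
  fix c assume "c \<in> oriented_span b"
  then obtain N :: "real^3^3" where N: "det N > 0" "\<And>i. c i = (\<Sum>j\<in>UNIV. N $ i $ j *\<^sub>R b j)"
    unfolding oriented_span_def by blast
  then have "det (N ** M) > 0" using assms(1) by (simp add: det_mul)
  then show "c \<in> oriented_span b'"
    unfolding oriented_span_def using triple_matrix_mult[OF assms(2) N(2)] by blast
qed

lemma oriented_span_eqI:
  fixes M :: "real^3^3"
  assumes "det M > 0" "\<And>i. b i = (\<Sum>j\<in>UNIV. M $ i $ j *\<^sub>R b' j)"
  shows "oriented_span b = oriented_span (b' :: 3 \<Rightarrow> 'l::real_vector)"
  using oriented_span_mono[OF assms]
    oriented_span_mono[OF det_matrix_inv_pos[OF assms(1)] triple_matrix_inv[OF _ assms(2)]] assms(1)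
  by force

lemma oriented_span_self: "b \<in> oriented_span b"
  unfolding oriented_span_def using triple_matrix_one[of _ b] by (force intro: exI[of _ "mat 1"])

lemma oriented_span_subset_span: "c \<in> oriented_span b \<Longrightarrow> c i \<in> span (range b)"
  unfolding oriented_span_def by (auto intro!: span_sum span_scale intro: span_base[OF rangeI])

lemma underlying_plane_oriented_span: "underlying_plane (oriented_span b) = span (range b)"
proof
  show "underlying_plane (oriented_span b) \<subseteq> span (range b)"
    unfolding underlying_plane_def
    by (rule UN_least) (rule span_minimal, auto intro: oriented_span_subset_span)
  show "span (range b) \<subseteq> underlying_plane (oriented_span b)"
    unfolding underlying_plane_def using oriented_span_self by blast
qed

lemma moment_expressionD:
  assumes "moment_expression A g Q \<mu> U I B" "y \<in> U"
  shows "quaternionic_frame A g Q U I" "smooth_fun A U (B i)"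
    "\<mu> y a = (\<Sum>i\<in>UNIV. (B i y \<bullet> a) *\<^sub>R I i y)"
  using assms by (simp_all add: moment_expression_def)

text \<open>If \<open>I'\<^sub>i = \<Sum>\<^sub>j M\<^sub>i\<^sub>j I\<^sub>j\<close>, comparing the coefficients of \<open>I\<^sub>j\<close> in \<open>\<mu> = \<Sum>\<^sub>i I\<^sub>i \<otimes> B\<^sub>i = \<Sum>\<^sub>i I'\<^sub>i \<otimes> B'\<^sub>i\<close> gives
  \<open>B = M\<^sup>T B'\<close>, and \<open>det M > 0\<close>.  So the description of \<open>induced_map\<close> is well defined.\<close>

lemma moment_expression_oriented_span_unique:
  fixes A :: "('m::{t2_space, second_countable_topology}, 'e::euclidean_space) chart set"
  assumes "smooth_atlas A" and rm: "riemannian_metric A g"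
    and e: "moment_expression A g Q \<mu> U I B" "y \<in> U"
    and e': "moment_expression A g Q \<mu> U' I' B'" "y \<in> U'"
  shows "oriented_span (\<lambda>i. B i y) = oriented_span (\<lambda>i. B' i y)"
proof -
  obtain W Z where "open W" "y \<in> W" "smooth_vfield A W Z" "Z y \<noteq> 0"
    using exists_nonvanishing_vfield[OF assms(1)] .
  then obtain z where z: "z \<in> tangent_space A y" "z \<noteq> 0" using smooth_vfield_tangent by blast
  have f: "quaternionic_frame A g Q U I" and f': "quaternionic_frame A g Q U' I'"
    using moment_expressionD(1) e e' by blast+
  obtain M :: "real^3^3" where M: "det M > 0" "\<And>i. I' i y = (\<Sum>j\<in>UNIV. M $ i $ j *\<^sub>R I j y)"
    using frame_transition[OF rm f e(2) f' e'(2) z] by blast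
  have "B j y = (\<Sum>i\<in>UNIV. transpose M $ j $ i *\<^sub>R B' i y)" for j
  proof (rule vector_eq_rdot[THEN iffD1, rule_format])
    fix a
    have "\<mu> y a = (\<Sum>i\<in>UNIV. (B i y \<bullet> a) *\<^sub>R I i y)"
      "\<mu> y a = (\<Sum>i\<in>UNIV. (B' i y \<bullet> a) *\<^sub>R I' i y)"
      using moment_expressionD(3)[OF e] moment_expressionD(3)[OF e'] by blast+
    then have "(\<Sum>i\<in>UNIV. (B i y \<bullet> a) *\<^sub>R I i y) z = (\<Sum>i\<in>UNIV. (B' i y \<bullet> a) *\<^sub>R I' i y) z"
      by simp
    then have "(B 1 y \<bullet> a - (\<Sum>i\<in>UNIV. M$i$1 * (B' i y \<bullet> a))) *\<^sub>R I 1 y z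
        + (B 2 y \<bullet> a - (\<Sum>i\<in>UNIV. M$i$2 * (B' i y \<bullet> a))) *\<^sub>R I 2 y z
        + (B 3 y \<bullet> a - (\<Sum>i\<in>UNIV. M$i$3 * (B' i y \<bullet> a))) *\<^sub>R I 3 y z + 0 *\<^sub>R z = 0"
      by (simp add: M(2) fun_sum_apply sum_3 algebra_simps)
    from frame_independent(1-3)[OF rm f e(2) z this]
    have "B j y \<bullet> a = (\<Sum>i\<in>UNIV. M$i$j * (B' i y \<bullet> a))" using exhaust_3[of j] by auto
    then show "B j y \<bullet> a = (\<Sum>i\<in>UNIV. transpose M $ j $ i *\<^sub>R B' i y) \<bullet> a"
      by (simp add: inner_sum_left transpose_def)
  qed
  then show ?thesis
    using oriented_span_eqI[of "transpose M" "\<lambda>i. B i y" "\<lambda>i. B' i y"] M(1) by (simp add: det_transpose)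
qed

lemma induced_map_eq:
  fixes A :: "('m::{t2_space, second_countable_topology}, 'e::euclidean_space) chart set"
  assumes "smooth_atlas A" "riemannian_metric A g" "moment_expression A g Q \<mu> U I B" "y \<in> U"
  shows "induced_map A g Q \<mu> y = oriented_span (\<lambda>i. B i y)"
  unfolding induced_map_def
  by (rule the_equality) (use assms moment_expression_oriented_span_unique in blast)+

section \<open>The chart of the Grassmannian\<close>

lemma orthonormal_triple_expand:
  assumes "orthonormal_triple_of V v" "w \<in> V"
  shows "w = (\<Sum>j\<in>UNIV. (v j \<bullet> w) *\<^sub>R v j)"
proof -
  obtain c where c: "w = (\<Sum>i\<in>UNIV. c i *\<^sub>R v i)"
    using assms span_range_sum unfolding orthonormal_triple_of_def by metis
  have "v j \<bullet> w = c j" for j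
    using assms(1) unfolding c orthonormal_triple_of_def
    by (simp add: inner_sum_right if_distrib[of "\<lambda>c. _ * c"] cong: if_cong)
  then show ?thesis using c by simp
qed

lemma orthonormal_triple_orthogonal_comp:
  assumes "orthonormal_triple_of V v"
  shows "a \<in> V\<^sup>\<bottom> \<longleftrightarrow> (\<forall>j. v j \<bullet> a = 0)"
proof
  show "\<forall>j. v j \<bullet> a = 0" if "a \<in> V\<^sup>\<bottom>"
  proof
    fix j
    have "v j \<in> V" using assms unfolding orthonormal_triple_of_def by (metis rangeI span_base)
    then show "v j \<bullet> a = 0" using that by (simp add: orthogonal_comp_def orthogonal_def)
  qed
  show "a \<in> V\<^sup>\<bottom>" if "\<forall>j. v j \<bullet> a = 0"
  proof -
    have "w \<bullet> a = 0" if "w \<in> V" for w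
      by (subst orthonormal_triple_expand[OF assms that])
         (simp add: inner_sum_left \<open>\<forall>j. v j \<bullet> a = 0\<close>)
    then show ?thesis by (simp add: orthogonal_comp_def orthogonal_def)
  qed
qed

text \<open>A plane spanned by \<open>b\<close> is the graph over \<open>V\<close> of the map with \<open>v\<^sub>j + L v\<^sub>j = \<Sum>\<^sub>k (C\<inverse>)\<^sub>j\<^sub>k b\<^sub>k\<close>,
  where \<open>C\<^sub>i\<^sub>j = \<langle>b\<^sub>i, v\<^sub>j\<rangle>\<close>: the right-hand sides are the vectors of the plane that project to the \<open>v\<^sub>j\<close>.\<close>

lemma grassmann_chart_eq:
  fixes b v :: "3 \<Rightarrow> 'l::euclidean_space"
  assumes v: "orthonormal_triple_of V v"
    and C: "C = (\<chi> i j. b i \<bullet> v j)" "det C > 0"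
    and l: "\<And>j. l j = (\<Sum>k\<in>UNIV. matrix_inv C $ j $ k *\<^sub>R b k) - v j"
  shows "grassmann_chart (oriented_span v) (oriented_span b) = (\<lambda>w. \<Sum>j\<in>UNIV. (v j \<bullet> w) *\<^sub>R l j)"
    and "l j \<in> V\<^sup>\<bottom>"
proof -
  have V: "span (range v) = V" and on: "\<And>i j. v i \<bullet> v j = (if i = j then 1 else 0)"
    using v by (simp_all add: orthonormal_triple_of_def)
  have inv: "matrix_inv C ** C = mat 1" using C(2) by (simp add: matrix_inv_mult)
  have lv: "v k \<bullet> l j = 0" for k j
  proof -
    have "v k \<bullet> (\<Sum>i\<in>UNIV. matrix_inv C $ j $ i *\<^sub>R b i) = (matrix_inv C ** C) $ j $ k"
      by (simp add: inner_sum_right matrix_matrix_mult_def C(1) inner_commute)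
    then show ?thesis by (simp add: l inner_diff_right on inv mat_def)
  qed
  then show perp: "l j \<in> V\<^sup>\<bottom>" for j using orthonormal_triple_orthogonal_comp[OF v] by blast
  define L where "L = (\<lambda>w. \<Sum>j\<in>UNIV. (v j \<bullet> w) *\<^sub>R l j)"
  have "linear L"
    unfolding L_def
    by (auto intro!: linearI simp: inner_add_right scaleR_left_distrib sum.distrib scaleR_sum_right)
  have Lv: "L (v j) = l j" for j
    unfolding L_def by (simp add: on if_distrib[of "\<lambda>c. c *\<^sub>R _"] cong: if_cong)
  have vL: "v j + L (v j) = (\<Sum>k\<in>UNIV. matrix_inv C $ j $ k *\<^sub>R b k)" for j
    unfolding Lv l by simp
  show "grassmann_chart (oriented_span v) (oriented_span b) = L"
    unfolding grassmann_chart_def underlying_plane_oriented_span V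
  proof (rule the_equality, intro conjI ballI)
    have "L w \<in> V\<^sup>\<bottom>" for w
      unfolding L_def orthonormal_triple_orthogonal_comp[OF v] by (simp add: inner_sum_right lv)
    moreover have "L w = 0" if "w \<in> V\<^sup>\<bottom>" for w
      using that unfolding L_def orthonormal_triple_orthogonal_comp[OF v] by simp
    ultimately show "L \<in> hom_perp V" using \<open>linear L\<close> unfolding hom_perp_def by blast
    \<comment> \<open>If \<open>c = N v\<close>, then \<open>c + L c = N C\<inverse> b\<close>, so the orientation is preserved because \<open>det N\<close> and
      \<open>det C\<close> are positive.\<close>
    fix c assume "c \<in> oriented_span v"
    then obtain N :: "real^3^3" where N: "det N > 0" "\<And>i. c i = (\<Sum>j\<in>UNIV. N $ i $ j *\<^sub>R v j)"
      unfolding oriented_span_def by blast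
    have "c i + L (c i) = (\<Sum>j\<in>UNIV. N $ i $ j *\<^sub>R (v j + L (v j)))" for i
      by (simp add: N(2) linear_sum[OF \<open>linear L\<close>] linear_scale[OF \<open>linear L\<close>]
          sum.distrib scaleR_right_distrib)
    from triple_matrix_mult[OF vL this]
    have "c i + L (c i) = (\<Sum>j\<in>UNIV. (N ** matrix_inv C) $ i $ j *\<^sub>R b j)" for i .
    moreover have "det (N ** matrix_inv C) > 0"
      using N(1) det_matrix_inv_pos[OF C(2)] by (simp add: det_mul)
    ultimately show "(\<lambda>i. c i + L (c i)) \<in> oriented_span b" unfolding oriented_span_def by blast
  next
    fix L' assume L': "L' \<in> hom_perp V \<and> (\<forall>c\<in>oriented_span v. (\<lambda>i. c i + L' (c i)) \<in> oriented_span b)"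
    then have "(\<lambda>i. v i + L' (v i)) \<in> oriented_span b" using oriented_span_self by blast
    \<comment> \<open>Uniqueness: pairing \<open>v\<^sub>i + L' v\<^sub>i = \<Sum>\<^sub>j N\<^sub>i\<^sub>j b\<^sub>j\<close> with \<open>v\<^sub>k\<close> gives \<open>N C = 1\<close>.\<close>
    then obtain N :: "real^3^3" where N: "\<And>i. v i + L' (v i) = (\<Sum>j\<in>UNIV. N $ i $ j *\<^sub>R b j)"
      unfolding oriented_span_def by blast
    have lin: "linear L'" and L'V: "\<And>w. w \<in> V \<Longrightarrow> L' w \<in> V\<^sup>\<bottom>" and L'0: "\<And>w. w \<in> V\<^sup>\<bottom> \<Longrightarrow> L' w = 0"
      using L' unfolding hom_perp_def by blast+
    have vV: "v j \<in> V" for j unfolding V[symmetric] by (simp add: span_base)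
    have "N ** C = mat 1"
    proof -
      have "(N ** C) $ i $ k = v k \<bullet> (v i + L' (v i))" for i k
        unfolding N by (simp add: inner_sum_right matrix_matrix_mult_def C(1) inner_commute)
      also have "\<dots> i k = mat 1 $ i $ k" for i k
        using L'V[OF vV] unfolding orthonormal_triple_orthogonal_comp[OF v]
        by (simp add: inner_add_right on mat_def)
      finally show ?thesis by (simp add: vec_eq_iff)
    qed
    have "C ** matrix_inv C = mat 1" using inv matrix_left_right_inverse by blast
    then have "N = N ** (C ** matrix_inv C)" by (simp only: matrix_mul_rid)
    also have "\<dots> = matrix_inv C"
      by (simp add: matrix_mul_assoc \<open>N ** C = mat 1\<close> matrix_mul_lid)
    finally have "N = matrix_inv C" .
    then have eqv: "L' (v j) = l j" for j using N vL Lv by (metis add_left_cancel)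
    show "L' = L"
    proof
      fix w
      let ?u = "\<Sum>j\<in>UNIV. (v j \<bullet> w) *\<^sub>R v j"
      have "w - ?u \<in> V\<^sup>\<bottom>"
        unfolding orthonormal_triple_orthogonal_comp[OF v]
        by (simp add: inner_diff_right inner_sum_right on if_distrib[of "\<lambda>c. _ * c"] cong: if_cong)
      from L'0[OF this] have "L' w = L' ?u" by (simp add: linear_diff[OF lin])
      then show "L' w = L w"
        by (simp add: L_def linear_sum[OF lin] linear_scale[OF lin] eqv)
    qed
  qed
qed

text \<open>By Cramer's rule the entries of the inverse are quotients of determinants of smooth entries.\<close>

lemma smooth_fun_matrix_inv:
  fixes C :: "_ \<Rightarrow> real^'n^'n"
  assumes "smooth_atlas A" "open W" "\<And>i j. smooth_fun A W (\<lambda>y. C y $ i $ j)"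
    and nz: "\<And>y. y \<in> W \<Longrightarrow> det (C y) \<noteq> 0"
  shows "smooth_fun A W (\<lambda>y. matrix_inv (C y) $ j $ k)"
proof -
  let ?M = "\<lambda>y. (\<chi> i l. if l = j then axis k 1 $ i else C y $ i $ l) :: real^'n^'n"
  have eq: "det (?M y) * inverse (det (C y)) = matrix_inv (C y) $ j $ k" if "y \<in> W" for y
  proof -
    have "C y ** matrix_inv (C y) = mat 1"
      using matrix_inv_mult[OF nz[OF that]] matrix_left_right_inverse by blast
    then have eq: "C y *v (matrix_inv (C y) *v axis k 1) = axis k 1"
      by (simp add: matrix_vector_mul_assoc)
    have "det (?M y) = (matrix_inv (C y) *v axis k 1) $ j * det (C y)"
      using cramer_lemma[of j "C y" "matrix_inv (C y) *v axis k 1"] unfolding eq .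
    moreover have "(matrix_inv (C y) *v axis k 1) $ j = matrix_inv (C y) $ j $ k"
      by (simp add: matrix_vector_mult_basis column_def)
    ultimately show ?thesis using nz[OF that] by simp
  qed
  have "smooth_fun A W (\<lambda>y. det (?M y))"
  proof (rule smooth_fun_det[OF assms(1,2)])
    show "smooth_fun A W (\<lambda>y. ?M y $ i $ l)" for i l
      using assms(3) smooth_fun_const[OF assms(1,2)] by (cases "l = j") simp_all
  qed
  then have "smooth_fun A W (\<lambda>y. det (?M y) * inverse (det (C y)))"
    by (rule smooth_fun_mult[OF assms(1,2) _ smooth_fun_inverse[OF assms(1,2) smooth_fun_det[OF assms(1-3)] nz]])
  then show ?thesis by (rule smooth_fun_cong[OF assms(1,2) _ eq])
qed

section \<open>Derivatives of the moment map\<close>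

lemma affine_connectionD:
  assumes "affine_connection A D" "open U" "p \<in> U" "smooth_vfield A U Z" "v \<in> tangent_space A p"
  shows affine_connection_local: "(\<And>y. y \<in> U \<Longrightarrow> Z' y = Z y) \<Longrightarrow> D p v Z' = D p v Z"
    and affine_connection_add: "smooth_vfield A U Z' \<Longrightarrow> D p v (\<lambda>y. Z y + Z' y) = D p v Z + D p v Z'"
    and affine_connection_scale:
      "smooth_fun A U f \<Longrightarrow> D p v (\<lambda>y. f y *\<^sub>R Z y) = v f *\<^sub>R Z p + f p *\<^sub>R D p v Z"
proof -
  note * = assms(1)[unfolded affine_connection_def, THEN conjunct1, THEN spec, THEN spec, THEN spec,
      THEN mp, OF conjI[OF assms(2) conjI[OF assms(3,4)]]]
  note loc = conjunct1[OF conjunct2[OF conjunct2[OF *]]]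
    and rest = conjunct2[OF conjunct2[OF conjunct2[OF *]]]
  show "D p v Z' = D p v Z" if "\<And>y. y \<in> U \<Longrightarrow> Z' y = Z y"
    by (rule mp[OF spec[OF bspec[OF loc assms(5)]]]) (rule ballI, rule that)
  show "D p v (\<lambda>y. Z y + Z' y) = D p v Z + D p v Z'" if "smooth_vfield A U Z'"
    by (rule mp[OF spec[OF bspec[OF conjunct1[OF rest] assms(5)]] that])
  show "D p v (\<lambda>y. f y *\<^sub>R Z y) = v f *\<^sub>R Z p + f p *\<^sub>R D p v Z" if "smooth_fun A U f"
    by (rule mp[OF spec[OF bspec[OF conjunct2[OF rest] assms(5)]] that])
qed

lemma smooth_endo_vfield:
  "smooth_endo A U J \<Longrightarrow> open W \<Longrightarrow> W \<subseteq> U \<Longrightarrow> smooth_vfield A W Z \<Longrightarrow> smooth_vfield A W (\<lambda>y. J y (Z y))"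
  by (simp add: smooth_endo_def)

lemma moment_map_has_cov_deriv:
  "moment_map A g D Q K \<mu> \<Longrightarrow> quaternionic_frame A g Q U I \<Longrightarrow> x \<in> U \<Longrightarrow> X \<in> tangent_space A x \<Longrightarrow>
    has_cov_deriv A D x X (\<lambda>y. \<mu> y a) (\<Sum>i\<in>UNIV. g x (I i x (K a x)) X *\<^sub>R I i x)"
  by (simp add: moment_map_def)

lemma has_cov_derivD:
  "has_cov_deriv A D p v J L \<Longrightarrow> open U \<Longrightarrow> p \<in> U \<Longrightarrow> smooth_vfield A U Z \<Longrightarrow>
    D p v (\<lambda>y. J y (Z y)) = L (Z p) + J p (D p v Z)"
  by (simp add: has_cov_deriv_def)

text \<open>Differentiate \<open>\<mu>\<^sub>a Z = \<Sum>\<^sub>i \<langle>B\<^sub>i, a\<rangle> I\<^sub>i Z\<close> covariantly, with \<open>Z\<close> a vector field nonzero at \<open>x\<close>.  As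
  all \<open>\<langle>B\<^sub>i, a\<rangle>\<close> vanish at \<open>x\<close>, the covariant derivatives of \<open>I\<^sub>i Z\<close> and of \<open>Z\<close> drop out, so the connection
  form of the frame never appears, and what remains is
  \<open>\<Sum>\<^sub>i X \<langle>B\<^sub>i, a\<rangle> I\<^sub>i Z = \<Sum>\<^sub>i g (I\<^sub>i K\<^sub>a, X) I\<^sub>i Z\<close>.\<close>

lemma moment_derivative:
  fixes A :: "('m::{t2_space, second_countable_topology}, 'e::euclidean_space) chart set"
  assumes atlas: "smooth_atlas A" and rm: "riemannian_metric A g" and conn: "affine_connection A D"
    and moment: "moment_map A g D Q K \<mu>"
    and e: "moment_expression A g Q \<mu> U I B" "x \<in> U" and X: "X \<in> tangent_space A x"
    and a: "\<And>i. B i x \<bullet> a = 0"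
  shows "X (\<lambda>y. B i y \<bullet> a) = g x (I i x (K a x)) X"
proof -
  note frame = moment_expressionD(1)[OF e]
  have U: "open U" and endo: "\<And>i. smooth_endo A U (I i)"
    using frame by (simp_all add: quaternionic_frame_def)
  obtain W0 Z where W0: "open W0" "x \<in> W0" and Z0: "smooth_vfield A W0 Z" and Zx: "Z x \<noteq> 0"
    using exists_nonvanishing_vfield[OF atlas] .
  define W where "W = W0 \<inter> U"
  have W: "open W" "x \<in> W" "W \<subseteq> U" using W0 U e(2) unfolding W_def by auto
  have Z: "smooth_vfield A W Z" using smooth_vfield_subset[OF Z0, of W] unfolding W_def by simp
  have f: "smooth_fun A W (\<lambda>y. B i y \<bullet> a)" for i
    using smooth_fun_subset[OF moment_expressionD(2)[OF e] W(3)]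
    by (rule smooth_fun_bounded_linear[OF atlas W(1) bounded_linear_inner_left])
  have J: "smooth_vfield A W (\<lambda>y. I i y (Z y))" for i
    using smooth_endo_vfield[OF endo W(1,3) Z] .
  let ?T = "\<lambda>i y. (B i y \<bullet> a) *\<^sub>R I i y (Z y)"
  have T: "smooth_vfield A W (?T i)" for i using smooth_vfield_scale[OF atlas J f] .
  note T12 = smooth_vfield_add[OF atlas T[of 1] T[of 2]]
  have DT: "D x X (?T i) = X (\<lambda>y. B i y \<bullet> a) *\<^sub>R I i x (Z x)" for i
    using affine_connection_scale[OF conn W(1,2) J X f, of i i] by (simp add: a)
  have "D x X (\<lambda>y. \<mu> y a (Z y)) = D x X (\<lambda>y. ?T 1 y + ?T 2 y + ?T 3 y)"
  proof (rule affine_connection_local[OF conn W(1,2) _ X])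
    show "smooth_vfield A W (\<lambda>y. ?T 1 y + ?T 2 y + ?T 3 y)"
      using smooth_vfield_add[OF atlas T12 T[of 3]] .
    show "\<mu> y a (Z y) = ?T 1 y + ?T 2 y + ?T 3 y" if "y \<in> W" for y
      using moment_expressionD(3)[OF e(1), of y a] that W(3) by (simp add: fun_sum_apply sum_3 subset_iff)
  qed
  also have "\<dots> = D x X (?T 1) + D x X (?T 2) + D x X (?T 3)"
    using affine_connection_add[OF conn W(1,2) T12 X T[of 3]]
      affine_connection_add[OF conn W(1,2) T[of 1] X T[of 2]] by simp
  finally have 1: "D x X (\<lambda>y. \<mu> y a (Z y)) = D x X (?T 1) + D x X (?T 2) + D x X (?T 3)" .
  have "\<mu> x a = 0" using moment_expressionD(3)[OF e, of a] by (simp add: a)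
  then have "D x X (\<lambda>y. \<mu> y a (Z y)) = (\<Sum>i\<in>UNIV. g x (I i x (K a x)) X *\<^sub>R I i x (Z x))"
    using has_cov_derivD[OF moment_map_has_cov_deriv[OF moment frame e(2) X, of a] W(1,2) Z]
    by (simp add: fun_sum_apply)
  with 1 have "(X (\<lambda>y. B 1 y \<bullet> a) - g x (I 1 x (K a x)) X) *\<^sub>R I 1 x (Z x)
      + (X (\<lambda>y. B 2 y \<bullet> a) - g x (I 2 x (K a x)) X) *\<^sub>R I 2 x (Z x)
      + (X (\<lambda>y. B 3 y \<bullet> a) - g x (I 3 x (K a x)) X) *\<^sub>R I 3 x (Z x) + 0 *\<^sub>R Z x = 0"
    by (simp add: DT sum_3 algebra_simps)
  from frame_independent(1-3)[OF rm frame e(2) smooth_vfield_tangent[OF Z W(2)] Zx this]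
  show ?thesis using exhaust_3[of i] by auto
qed

text \<open>The push-forward under the orbit map lies over \<open>1 \<cdot> x\<close>, which is \<open>x\<close>.\<close>

lemma generated_field_tangent:
  fixes A :: "('m::{t2_space, second_countable_topology}, 'e::euclidean_space) chart set"
    and AG :: "('g::{t2_space, second_countable_topology}, 'f::euclidean_space) chart set"
  assumes "smooth_atlas A" "lie_group AG G" "lie_algebra_of AG G br \<iota>" "smooth_action AG A G act"
  shows "generated_field A G act \<iota> a x \<in> tangent_space A x"
proof -
  have AG: "smooth_atlas AG" using assms(2) by (simp add: lie_group_def)
  have act: "group_action G UNIV act" "smooth_map (prod_atlas AG A) A (\<lambda>(h, x). act h x)"
    using assms(4) by (simp_all add: smooth_action_def)
  have "\<iota> a \<in> tangent_space AG \<one>\<^bsub>G\<^esub>"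
    using assms(3) by (auto simp: lie_algebra_of_def bij_betw_def)
  from pushforward_tangent[OF AG assms(1) orbit_map_smooth[OF AG assms(1) act(2)] this]
  have "generated_field A G act \<iota> a x \<in> tangent_space A (act \<one>\<^bsub>G\<^esub> x)"
    by (simp add: generated_field_def)
  moreover have "act \<one>\<^bsub>G\<^esub> x = x"
    using fun_cong[OF group_action.id_eq_one[OF act(1)], of x] by simp
  ultimately show ?thesis by simp
qed

section \<open>The differential of the induced map\<close>

text \<open>Near \<open>x\<close> the chart value of \<open>\<Psi>\<close> is \<open>\<Sum>\<^sub>j v\<^sub>j \<otimes> l\<^sub>j\<close>, where \<open>\<Sum>\<^sub>j C\<^sub>i\<^sub>j (v\<^sub>j + l\<^sub>j) = B\<^sub>i\<close> and
  \<open>C\<^sub>i\<^sub>j = \<langle>B\<^sub>i, v\<^sub>j\<rangle>\<close>.  Pairing with \<open>a \<in> V\<^sup>\<bottom>\<close> removes the \<open>v\<^sub>j\<close>.  At \<open>x\<close> the matrix is \<open>c\<close> times the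
  identity and \<open>l\<^sub>j = 0\<close>, so the Leibniz rule leaves \<open>c X \<langle>l\<^sub>i, a\<rangle> = X \<langle>B\<^sub>i, a\<rangle>\<close>, and the moment map equation
  gives the right-hand side.\<close>

lemma grassmann_differential_induced_map:
  fixes A :: "('m::{t2_space, second_countable_topology}, 'e::euclidean_space) chart set"
    and B :: "3 \<Rightarrow> 'm \<Rightarrow> 'l::euclidean_space"
  assumes atlas: "smooth_atlas A" and rm: "riemannian_metric A g" and conn: "affine_connection A D"
    and moment: "moment_map A g D Q K \<mu>"
    and e: "moment_expression A g Q \<mu> U I B" "x \<in> U" and X: "X \<in> tangent_space A x"
    and v: "orthonormal_triple_of V v" and Bx: "\<And>i. B i x = c *\<^sub>R v i" and c: "c > 0"
    and R: "orthonormal_basis_of (V\<^sup>\<bottom>) R"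
  shows "grassmann_differential (induced_map A g Q \<mu>) x X =
    (\<Sum>j\<in>UNIV. tensor (v j) ((1 / c) *\<^sub>R rho K x R (\<lambda>Z. g x (I j x Z) X)))"
proof -
  have U: "open U" using moment_expressionD(1)[OF e] by (simp add: quaternionic_frame_def)
  have on: "\<And>i j. v i \<bullet> v j = (if i = j then 1 else 0)"
    using v by (simp add: orthonormal_triple_of_def)
  define C :: "'m \<Rightarrow> real^3^3" where "C y = (\<chi> i j. B i y \<bullet> v j)" for y
  define N where "N = U \<inter> (\<lambda>y. det (C y)) -` {0<..}"
  define l where "l j y = (\<Sum>k\<in>UNIV. matrix_inv (C y) $ j $ k *\<^sub>R B k y) - v j" for j y
  have Ba: "smooth_fun A U (\<lambda>y. B i y \<bullet> a)" for i a
    by (rule smooth_fun_bounded_linear[OF atlas U bounded_linear_inner_left moment_expressionD(2)[OF e]])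
  have CU: "smooth_fun A U (\<lambda>y. C y $ i $ j)" for i j by (simp add: C_def Ba)
  have "continuous_on U (\<lambda>y. det (C y))"
    by (rule smooth_fun_continuous_on[OF atlas U smooth_fun_det[OF atlas U CU]])
  then have N: "open N" unfolding N_def using continuous_open_preimage[OF _ U open_greaterThan] by blast
  have Cx: "C x $ i $ j = (if i = j then c else 0)" for i j by (simp add: C_def Bx on)
  then have "det (C x) = c ^ 3" by (simp add: det_3 power3_eq_cube)
  then have x: "x \<in> N" using e(2) c by (simp add: N_def)
  have NU: "N \<subseteq> U" and detC: "\<And>y. y \<in> N \<Longrightarrow> det (C y) > 0" by (auto simp: N_def)
  have ev: "eventually (\<lambda>y. y \<in> N) (nhds x)" using N x by (rule eventually_nhds_in_open)
  have CN: "smooth_fun A N (\<lambda>y. C y $ i $ j)" for i j by (rule smooth_fun_subset[OF CU NU])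
  have BN: "smooth_fun A N (\<lambda>y. B i y \<bullet> a)" for i a by (rule smooth_fun_subset[OF Ba NU])
  have invN: "smooth_fun A N (\<lambda>y. matrix_inv (C y) $ j $ k)" for j k
    by (rule smooth_fun_matrix_inv[OF atlas N CN]) (use detC in force)
  have "smooth_fun A N (\<lambda>y. (\<Sum>k\<in>UNIV. matrix_inv (C y) $ j $ k * (B k y \<bullet> a)) + - (v j \<bullet> a))" for j a
    by (intro smooth_fun_add[OF atlas N] smooth_fun_sum[OF atlas N] smooth_fun_mult[OF atlas N]
        smooth_fun_const[OF atlas N] invN BN)
  then have "smooth_fun A N (\<lambda>y. l j y \<bullet> a)" for j a
    by (simp add: l_def inner_diff_left inner_sum_left)
  then have l_near: "smooth_near A x (\<lambda>y. l j y \<bullet> a)" for j a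
    by (rule smooth_nearI[OF N x])
  have scale_near: "smooth_near A x (\<lambda>y. r * f y)" if "smooth_near A x f" for r f
    using smooth_near_add_mult(2)[OF atlas smooth_near_const[OF atlas] that] .

  have "oriented_span (\<lambda>i. B i x) = oriented_span v"
  proof (rule oriented_span_eqI)
    show "det (C x) > 0" using detC x by blast
    show "B i x = (\<Sum>j\<in>UNIV. C x $ i $ j *\<^sub>R v j)" for i
      by (simp add: Bx Cx if_distrib[of "\<lambda>c. c *\<^sub>R _"] cong: if_cong)
  qed
  then have Psix: "induced_map A g Q \<mu> x = oriented_span v"
    using induced_map_eq[OF atlas rm e] by simp
  have chart: "grassmann_chart (induced_map A g Q \<mu> x) (induced_map A g Q \<mu> y) w = (\<Sum>j\<in>UNIV. (v j \<bullet> w) *\<^sub>R l j y)"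
    and perp: "l j y \<in> V\<^sup>\<bottom>" if "y \<in> N" for y j w
    using grassmann_chart_eq[OF v C_def detC[OF that] l_def] NU that
      induced_map_eq[OF atlas rm e(1), of y] Psix by (auto simp: fun_eq_iff)

  \<comment> \<open>The derivative of the vector-valued \<open>l\<^sub>j\<close> along \<open>X\<close>, assembled from components since \<open>X\<close> acts on
    real functions.\<close>
  define q where "q j = (\<Sum>b\<in>Basis. X (\<lambda>y. l j y \<bullet> b) *\<^sub>R b)" for j
  have q_inner: "a \<bullet> q j = X (\<lambda>y. l j y \<bullet> a)" for j a
  proof -
    have "X (\<lambda>y. l j y \<bullet> a) = X (\<lambda>y. \<Sum>b\<in>Basis. (a \<bullet> b) * (l j y \<bullet> b))"
      by (subst euclidean_inner) (simp add: mult.commute)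
    also have "\<dots> = (\<Sum>b\<in>Basis. (a \<bullet> b) * X (\<lambda>y. l j y \<bullet> b))"
      by (simp add: tangent_sum[OF atlas X] scale_near l_near tangent_scale[OF X])
    finally show ?thesis
      by (simp add: q_def inner_sum_right inner_commute[of _ a] mult.commute)
  qed
  have "X (\<lambda>y. grassmann_chart (induced_map A g Q \<mu> x) (induced_map A g Q \<mu> y) w \<bullet> b)
      = (\<Sum>j\<in>UNIV. (v j \<bullet> w) * X (\<lambda>y. l j y \<bullet> b))" for w b
  proof -
    have "X (\<lambda>y. grassmann_chart (induced_map A g Q \<mu> x) (induced_map A g Q \<mu> y) w \<bullet> b)
        = X (\<lambda>y. \<Sum>j\<in>UNIV. (v j \<bullet> w) * (l j y \<bullet> b))"
      by (rule tangent_cong[OF X, symmetric])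
         (auto intro!: smooth_near_sum[OF atlas] scale_near l_near eventually_mono[OF ev]
            simp: chart inner_sum_left)
    then show ?thesis
      by (simp add: tangent_sum[OF atlas X] scale_near l_near tangent_scale[OF X])
  qed
  then have diff: "grassmann_differential (induced_map A g Q \<mu>) x X = (\<lambda>w. \<Sum>j\<in>UNIV. (v j \<bullet> w) *\<^sub>R q j)"
    unfolding grassmann_differential_def q_def scaleR_sum_right scaleR_sum_left
    by (subst sum.swap) (simp add: scaleR_sum_left)

  have X0: "X (\<lambda>y. 0) = 0" using tangent_scale[OF X smooth_near_const[OF atlas], of 0] by simp
  have "q j \<bullet> v k = 0" for j k
  proof -
    have "X (\<lambda>y. 0) = X (\<lambda>y. l j y \<bullet> v k)"
      by (rule tangent_cong[OF X smooth_near_const[OF atlas]])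
         (use perp in \<open>auto intro!: eventually_mono[OF ev]
            simp: orthonormal_triple_orthogonal_comp[OF v] inner_commute\<close>)
    then have "v k \<bullet> q j = 0" using X0 q_inner by simp
    then show ?thesis by (simp add: inner_commute)
  qed
  then have q_perp: "q j \<in> V\<^sup>\<bottom>" for j
    by (simp add: orthonormal_triple_orthogonal_comp[OF v] inner_commute)

  have q_eq: "q i \<bullet> a = (1 / c) * g x (I i x (K a x)) X" if a: "a \<in> V\<^sup>\<bottom>" for i a
  proof -
    have va: "v j \<bullet> a = 0" for j using a orthonormal_triple_orthogonal_comp[OF v] by blast
    have B: "B i y \<bullet> a = (\<Sum>j\<in>UNIV. C y $ i $ j * (l j y \<bullet> a))" if "y \<in> N" for y i
    proof -
      have "C y ** matrix_inv (C y) = mat 1"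
        using matrix_inv_mult[of "C y"] detC[OF that] matrix_left_right_inverse by force
      then have "(\<Sum>j\<in>UNIV. C y $ i $ j *\<^sub>R (v j + l j y)) = B i y"
        using triple_matrix_mult[of "\<lambda>j. v j + l j y" "matrix_inv (C y)" "\<lambda>k. B k y"
            "\<lambda>i. \<Sum>j\<in>UNIV. C y $ i $ j *\<^sub>R (v j + l j y)" "C y" i]
        by (simp add: l_def triple_matrix_one)
      then have "B i y \<bullet> a = (\<Sum>j\<in>UNIV. C y $ i $ j *\<^sub>R (v j + l j y)) \<bullet> a" by simp
      then show ?thesis by (simp add: inner_sum_left inner_add_left va)
    qed
    have lx: "l i x \<bullet> a = 0" for i
      using B[OF x, of i] c
      by (simp add: Bx va Cx if_distrib[of "\<lambda>c. c * _"] cong: if_cong)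
    have C_near: "smooth_near A x (\<lambda>y. C y $ i $ j)" for i j by (rule smooth_nearI[OF N x CN])
    have "X (\<lambda>y. B i y \<bullet> a) = X (\<lambda>y. \<Sum>j\<in>UNIV. C y $ i $ j * (l j y \<bullet> a))"
      by (rule tangent_cong[OF X smooth_nearI[OF N x BN]]) (rule eventually_mono[OF ev B])
    also have "\<dots> = (\<Sum>j\<in>UNIV. C x $ i $ j * X (\<lambda>y. l j y \<bullet> a))"
      by (simp add: tangent_sum[OF atlas X] smooth_near_add_mult(2)[OF atlas] C_near l_near
          tangent_mult[OF X] lx)
    also have "\<dots> = c * X (\<lambda>y. l i y \<bullet> a)"
      by (simp add: Cx if_distrib[of "\<lambda>c. c * _"] cong: if_cong)
    also have "\<dots> = c * (q i \<bullet> a)" using q_inner[of a i] by (simp only: inner_commute[of a])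
    finally have "c * (q i \<bullet> a) = g x (I i x (K a x)) X"
      using moment_derivative[OF atlas rm conn moment e X, of a i] by (simp add: Bx va)
    then show ?thesis using c by (simp add: field_simps)
  qed
  have "q j = (1 / c) *\<^sub>R rho K x R (\<lambda>Z. g x (I j x Z) X)" for j
  proof -
    have RV: "finite R" "pairwise orthogonal R" "\<And>a. a \<in> R \<Longrightarrow> norm a = 1" "span R = V\<^sup>\<bottom>"
      using R by (simp_all add: orthonormal_basis_of_def)
    have "q j = (\<Sum>a\<in>R. (q j \<bullet> a) *\<^sub>R a)"
      using orthonormal_basis_expand[OF RV(2,3) _ RV(1)] q_perp RV(4) by metis
    also have "\<dots> = (\<Sum>a\<in>R. ((1 / c) * g x (I j x (K a x)) X) *\<^sub>R a)"
      by (rule sum.cong[OF refl]) (subst q_eq, use RV(4) span_base[of _ R] in auto)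
    finally show ?thesis by (simp add: rho_def scaleR_sum_right)
  qed
  then show ?thesis by (simp add: diff fun_eq_iff fun_sum_apply tensor_def)
qed

section \<open>The quaternionic equation for the induced map\<close>

lemma rho_cong: "(\<And>a. \<zeta> (K a x) = \<zeta>' (K a x)) \<Longrightarrow> rho K x R \<zeta> = rho K x R \<zeta>'"
  by (simp add: rho_def)

lemma rho_minus: "rho K x R (\<lambda>Z. - \<zeta> Z) = - rho K x R \<zeta>"
  by (simp add: rho_def sum_negf)

theorem proposition5p4:
  fixes A :: "('m::{t2_space, second_countable_topology}, 'e::euclidean_space) chart set"
    and g :: "'m metric" and D :: "'m conn" and Q :: "'m \<Rightarrow> 'm endo set"
    and AG :: "('g::{t2_space, second_countable_topology}, 'f::euclidean_space) chart set"
    and G :: "'g monoid" and act :: "'g \<Rightarrow> 'm \<Rightarrow> 'm"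
    and br :: "'l::euclidean_space \<Rightarrow> 'l \<Rightarrow> 'l" and \<iota> :: "'l \<Rightarrow> 'g tvec"
    and \<mu> :: "'m \<Rightarrow> 'l \<Rightarrow> 'm endo"
    and lam :: "'m \<Rightarrow> real"
    and U :: "'m set" and I :: "3 \<Rightarrow> 'm \<Rightarrow> 'm endo" and B :: "3 \<Rightarrow> 'm \<Rightarrow> 'l"
    and x :: 'm and Y :: "'m tvec" and v p :: "3 \<Rightarrow> 'l" and R :: "'l set"
  defines "K \<equiv> generated_field A G act \<iota>"
    and "\<Psi> \<equiv> induced_map A g Q \<mu>"
    and "M\<^sub>0 \<equiv> regular_set A g Q \<mu>"
  defines "V \<equiv> underlying_plane (\<Psi> x)"
  assumes qk: "qk_manifold A g D Q"
    and scal: "\<And>y. scalar_curvature A g D y \<noteq> 0"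
    and lie_group: "lie_group AG G" and compact: "compact (UNIV :: 'g set)"
    and lie_algebra: "lie_algebra_of AG G br \<iota>"
    and inner: "\<And>a b. a \<bullet> b = - killing_form br a b"
    and action: "smooth_action AG A G act"
    and isometries: "\<And>h. quaternionic_isometry A g Q (act h)"
    and moment: "moment_map A g D Q K \<mu>"
    and lambda_smooth: "smooth_fun A M\<^sub>0 lam"
    and lambda_pos: "\<And>y. y \<in> M\<^sub>0 \<Longrightarrow> lam y > 0"
    and lambda_invariant: "\<And>h y. y \<in> M\<^sub>0 \<Longrightarrow> lam (act h y) = lam y"
    and lambda: "\<And>U' I' B' y. moment_expression A g Q \<mu> U' I' B' \<Longrightarrow> y \<in> U' \<inter> M\<^sub>0 \<Longrightarrow>
       \<exists>v'. orthonormal_triple_of (underlying_plane (\<Psi> y)) v' \<and> (\<forall>i. B' i y = lam y *\<^sub>R v' i)"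
    and x: "x \<in> M\<^sub>0" "x \<in> U" and Y: "Y \<in> tangent_space A x"
    and frame: "moment_expression A g Q \<mu> U I B"
    and v: "orthonormal_triple_of V v" "\<And>i. B i x = lam x *\<^sub>R v i"
    and R: "orthonormal_basis_of (V\<^sup>\<bottom>) R"
    and p: "\<And>i. p i \<in> V\<^sup>\<bottom>"
    and dPsi_Y: "grassmann_differential \<Psi> x Y =
       tensor (v 1) (p 1) + tensor (v 2) (p 2) + tensor (v 3) (p 3)"
  shows "grassmann_differential \<Psi> x (I 1 x Y) =
    (1 / lam x) *\<^sub>R tensor (v 1) (rho K x R (flat g x Y)) - tensor (v 2) (p 3) + tensor (v 3) (p 2)"
proof -
  have atlas: "smooth_atlas A" and rm: "riemannian_metric A g" and conn: "affine_connection A D"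
    using qk by (simp_all add: qk_manifold_def levi_civita_def)
  note quat = rm moment_expressionD(1)[OF frame x(2)] x(2)
  have KT: "K a x \<in> tangent_space A x" for a
    unfolding K_def by (rule generated_field_tangent[OF atlas lie_group lie_algebra action])
  have IYT: "I i x Y \<in> tangent_space A x" for i by (rule frame_tangent[OF quat Y])
  \<comment> \<open>The component of \<open>\<Psi>\<^sub>* X\<close> in \<open>V\<^sup>\<bottom>\<close> that is paired with \<open>v\<^sub>j\<close>.\<close>
  define r where "r j X = (1 / lam x) *\<^sub>R rho K x R (\<lambda>Z. g x (I j x Z) X)" for j X
  have diff: "grassmann_differential \<Psi> x X = tensor (v 1) (r 1 X) + tensor (v 2) (r 2 X) + tensor (v 3) (r 3 X)"
    if "X \<in> tangent_space A x" for X
    using grassmann_differential_induced_map[OF atlas rm conn moment frame x(2) that v(1) v(2)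
        lambda_pos[OF x(1)] R]
    by (simp add: \<Psi>_def r_def sum_3)
  have on: "v i \<bullet> v j = (if i = j then 1 else 0)" for i j
    using v(1) by (simp add: orthonormal_triple_of_def)
  have "tensor (v 1) (r 1 Y) + tensor (v 2) (r 2 Y) + tensor (v 3) (r 3 Y)
      = tensor (v 1) (p 1) + tensor (v 2) (p 2) + tensor (v 3) (p 3)"
    using diff[OF Y] dPsi_Y by simp
  from fun_cong[OF this, of "v 2"] fun_cong[OF this, of "v 3"]
  have pr: "p 2 = r 2 Y" "p 3 = r 3 Y" by (simp_all add: tensor_def on)
  have "r 1 (I 1 x Y) = (1 / lam x) *\<^sub>R rho K x R (flat g x Y)"
    unfolding r_def flat_def
    by (intro arg_cong[of _ _ "scaleR _"] rho_cong)
       (simp add: frame_isometry[OF quat KT Y] metric_sym[OF rm KT Y])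
  \<comment> \<open>\<open>\<langle>I\<^sub>2 K\<^sub>a, I\<^sub>1 Y\<rangle> = - \<langle>K\<^sub>a, I\<^sub>2 I\<^sub>1 Y\<rangle> = \<langle>K\<^sub>a, I\<^sub>3 Y\<rangle> = - \<langle>I\<^sub>3 K\<^sub>a, Y\<rangle>\<close>\<close>
  moreover have "r 2 (I 1 x Y) = - p 3"
  proof -
    have "g x (I 2 x (K a x)) (I 1 x Y) = - g x (I 3 x (K a x)) Y" for a
      by (simp add: frame_skew[OF quat KT] IYT Y frame_anticyclic[OF quat Y]
          metric_minus_right[OF rm KT IYT])
    then show ?thesis
      unfolding pr r_def scaleR_minus_right[symmetric] rho_minus[symmetric]
      by (intro arg_cong[of _ _ "scaleR _"] rho_cong)
  qed
  \<comment> \<open>\<open>\<langle>I\<^sub>3 K\<^sub>a, I\<^sub>1 Y\<rangle> = - \<langle>K\<^sub>a, I\<^sub>3 I\<^sub>1 Y\<rangle> = - \<langle>K\<^sub>a, I\<^sub>2 Y\<rangle> = \<langle>I\<^sub>2 K\<^sub>a, Y\<rangle>\<close>\<close>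
  moreover have "r 3 (I 1 x Y) = p 2"
  proof -
    have "g x (I 3 x (K a x)) (I 1 x Y) = g x (I 2 x (K a x)) Y" for a
      by (simp add: frame_skew[OF quat KT] IYT Y frame_cyclic[OF quat Y])
    then show ?thesis unfolding pr r_def by (intro arg_cong[of _ _ "scaleR _"] rho_cong)
  qed
  ultimately show ?thesis
    by (simp add: diff[OF IYT] fun_eq_iff tensor_def)
qed

end
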